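(* Consider the linearly constrained problem (P) of the context under its assumptions. Given $\varepsilon>0$, choose $\varepsilon_0=\varepsilon$, $\sigma=1/2$ and $\rho=\varepsilon^{-1}$. Then the I-ALM algorithm (defined in the context) finds an $\varepsilon$-primal-dual solution to (P) in $$\tilde{\mathcal O}\left((1+R_\Lambda^2)\left(1+D\left(\frac{\sqrt{L_f}}{\sqrt\varepsilon}+\frac{\|A\|}{\varepsilon}\right)\right)\right)$$ ACG iterations (summed over all inner calls), where $R_\Lambda=\min\{\|\lambda-\lambda_0\|:\lambda\in\Lambda_*\}$ and $\Lambda_*$ is the set of maximizers of the Lagrangian dual function $d$.
   Context: Problem (P): $\hat\phi_*=\min\{\phi(x):=f(x)+h(x):Ax=b\}$, $A\in\mathbb{R}^{m\times n}$, $b\in\mathbb{R}^m$, $m\le n$. Assumptions: $f$ is proper closed convex and $L_f$-smooth on $\mathbb{R}^n$ ($\nabla f$ is $L_f$-Lipschitz); $h$ is proper closed convex with computable proximal mapping, $\operatorname{dom}h\subset\operatorname{dom}f$; $\operatorname{relint}(\operatorname{dom}h)\cap\{x:Ax=b\}\neq\emptyset$; $\operatorname{dom}h$ is bounded with diameter $D\ge1$. $\|A\|$ is the spectral norm. Lagrangian $\mathcal L(x,\lambda)=\phi(x)+\langle\lambda,Ax-b\rangle$; dual $d(\lambda)=\min_x\mathcal L(x,\lambda)$; augmented Lagrangian $\mathcal L_\rho(x,\lambda)=\mathcal L(x,\lambda)+\frac\rho2\|Ax-b\|^2$, with smooth part $\Psi_\lambda(x)=f(x)+\langle\lambda,Ax-b\rangle+\frac\rho2\|Ax-b\|^2$;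 $M_\rho=L_f+\rho\|A\|^2$. $(x,\lambda)$ is an $\varepsilon$-primal-dual solution if there is $v\in\partial h(x)+\nabla f(x)+A^\top\lambda$ with $\|v\|\le\varepsilon$, and $\|Ax-b\|\le\varepsilon$. Gradient mapping: for $F=s+h$ with $s$ smooth, $\mathcal G_F^\eta(x)=\frac1\eta\big(x-\operatorname{prox}_{\eta h}(x-\eta\nabla s(x))\big)$, where $\operatorname{prox}_{\eta h}(z)=\operatorname{argmin}_y\{\eta h(y)+\frac12\|z-y\|^2\}$. For $\mathcal L_\rho(\cdot,\lambda)$ the smooth part is $\Psi_\lambda$. ACG, applied to $\psi=g+h$ ($g$ $\mu$-strongly convex, $(L+\mu)$-smooth) from $p_0$: $S_0=0$, $\tau_0=1$, $q_0=p_0$; iteration $j=0,1,\dots$: $s_j=\frac{\tau_j+\sqrt{\tau_j^2+8\tau_jS_jL}}{4L}$, $S_{j+1}=S_j+s_j$, $\tau_{j+1}=\tau_j+\mu s_j$, $\tilde p_j=\frac{S_j}{S_{j+1}}q_j+\frac{s_j}{S_{j+1}}p_j$; $\tilde q_{j+1}=\operatorname{argmin}_u\{g(\tilde p_j)+\langle\nabla g(\tilde p_j),u-\tilde p_j\rangle+h(u)+\frac{2L+\mu}2\|u-\tilde p_j\|^2\}$; $q_{j+1}$ is a point of $\{q_j,\tilde q_{j+1}\}$ with smallest $\psi$-value; $p_{j+1}=\frac{(2L+\mu)s_j\tilde q_{j+1}-\frac{2S_js_jL}{S_{j+1}}q_j}{S_{j+1}\mu+1}$. I-ALM. Input $x_0\in\operatorname{dom}h$,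 $\rho>0$, $\varepsilon_0>0$, $\alpha\in(0,1)$, $\varepsilon>0$, $\sigma\in(0,1)$ with $2\sigma\rho\le D/\varepsilon$; $\lambda_0=0$. For $k=0,1,\dots$: 1. Set $\varepsilon_k=(\varepsilon_0\alpha^k+\sigma\rho\varepsilon^2)/2$ (for the current $k$, with $\varepsilon_0$ on the right the input). Run ACG from $p_0=x_k$ with $\psi=\mathcal L_\rho(\cdot,\lambda_k)+\frac{\varepsilon_k}{8D^2}\|\cdot-x_k\|^2$, $g=\Psi_{\lambda_k}+\frac{\varepsilon_k}{8D^2}\|\cdot-x_k\|^2$, $L=M_\rho$, $\mu=\frac{\varepsilon_k}{4D^2}$, until one of its points $\tilde x_k:=\tilde p_j$ satisfies $\|\mathcal G^{(2L+\mu)^{-1}}_{\mathcal L_\rho(\cdot,\lambda_k)}(\tilde x_k)\|\le\varepsilon_k/(2D)$. Set $x_{k+1}=\tilde x_k-(2L+\mu)^{-1}\mathcal G^{(2L+\mu)^{-1}}_{\mathcal L_\rho(\cdot,\lambda_k)}(\tilde x_k)$. 2. $\lambda_{k+1}=\lambda_k+\rho(Ax_{k+1}-b)$. 3. If $\|\mathcal G^{(2L+\mu)^{-1}}_{\mathcal L_\rho(\cdot,\lambda_k)}(\tilde x_k)\|\le\varepsilon/2$ and $\|Ax_{k+1}-b\|\le\varepsilon$, return $(x_{k+1},\lambda_{k+1})$. $\tilde{\mathcal O}$ suppresses absolute constants, constants depending only on $\alpha$, and logarithmic factors in the problem and algorithm parameters. *)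

theory Defs
  imports "HOL-Analysis.Analysis"
begin

section \<open>Convex analysis for extended-real-valued functions\<close>

definition ext_dom :: "('a \<Rightarrow> ereal) \<Rightarrow> 'a set" where
  "ext_dom h = {x. h x < \<infinity>}"

definition ext_epigraph :: "('a \<Rightarrow> ereal) \<Rightarrow> ('a \<times> real) set" where
  "ext_epigraph h = {(x, r). h x \<le> ereal r}"

definition proper_closed_convex :: "('a::real_normed_vector \<Rightarrow> ereal) \<Rightarrow> bool" where
  "proper_closed_convex h \<longleftrightarrow>
     (\<forall>x. h x \<noteq> -\<infinity>) \<and> (\<exists>x. h x \<noteq> \<infinity>) \<and>
     closed (ext_epigraph h) \<and> convex (ext_epigraph h)"

text \<open>At points outside the domain of a proper \<open>h\<close> this is the empty set, as usual.\<close>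
definition subdifferential :: "('a::real_inner \<Rightarrow> ereal) \<Rightarrow> 'a \<Rightarrow> 'a set" where
  "subdifferential h x = {g. \<forall>y. h x + ereal (g \<bullet> (y - x)) \<le> h y}"

definition grad :: "('a::real_inner \<Rightarrow> real) \<Rightarrow> 'a \<Rightarrow> 'a" where
  "grad s x = (THE D. GDERIV s x :> D)"

definition smooth_with :: "real \<Rightarrow> ('a::real_inner \<Rightarrow> real) \<Rightarrow> bool" where
  "smooth_with L s \<longleftrightarrow> (\<forall>x. \<exists>D. GDERIV s x :> D) \<and> L-lipschitz_on UNIV (grad s)"

definition prox :: "real \<Rightarrow> ('a::real_inner \<Rightarrow> ereal) \<Rightarrow> 'a \<Rightarrow> 'a" where
  "prox \<eta> h z = arg_min (\<lambda>y. ereal \<eta> * h y + ereal ((norm (z - y))\<^sup>2 / 2)) (\<lambda>_. True)"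

definition grad_map ::
    "real \<Rightarrow> ('a::real_inner \<Rightarrow> real) \<Rightarrow> ('a \<Rightarrow> ereal) \<Rightarrow> 'a \<Rightarrow> 'a" where
  "grad_map \<eta> s h x = (1 / \<eta>) *\<^sub>R (x - prox \<eta> h (x - \<eta> *\<^sub>R grad s x))"


section \<open>The linearly constrained problem and its Lagrangian dual\<close>

definition spectral_norm :: "real^'n^'m \<Rightarrow> real" where
  "spectral_norm A = onorm (\<lambda>x. A *v x)"

definition lagrangian ::
    "(real^'n \<Rightarrow> real) \<Rightarrow> (real^'n \<Rightarrow> ereal) \<Rightarrow> real^'n^'m \<Rightarrow> real^'m \<Rightarrow>
     real^'n \<Rightarrow> real^'m \<Rightarrow> ereal" where
  "lagrangian f h A b x lam = ereal (f x) + h x + ereal (lam \<bullet> (A *v x - b))"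

definition dual_fun ::
    "(real^'n \<Rightarrow> real) \<Rightarrow> (real^'n \<Rightarrow> ereal) \<Rightarrow> real^'n^'m \<Rightarrow> real^'m \<Rightarrow> real^'m \<Rightarrow> ereal" where
  "dual_fun f h A b lam = (INF x. lagrangian f h A b x lam)"

definition dual_maximizers ::
    "(real^'n \<Rightarrow> real) \<Rightarrow> (real^'n \<Rightarrow> ereal) \<Rightarrow> real^'n^'m \<Rightarrow> real^'m \<Rightarrow> (real^'m) set" where
  "dual_maximizers f h A b = {lam. \<forall>\<nu>. dual_fun f h A b \<nu> \<le> dual_fun f h A b lam}"

definition dual_radius ::
    "(real^'n \<Rightarrow> real) \<Rightarrow> (real^'n \<Rightarrow> ereal) \<Rightarrow> real^'n^'m \<Rightarrow> real^'m \<Rightarrow> real^'m \<Rightarrow> real" where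
  "dual_radius f h A b lam0 = Inf ((\<lambda>lam. norm (lam - lam0)) ` dual_maximizers f h A b)"

definition eps_primal_dual ::
    "(real^'n \<Rightarrow> real) \<Rightarrow> (real^'n \<Rightarrow> ereal) \<Rightarrow> real^'n^'m \<Rightarrow> real^'m \<Rightarrow> real \<Rightarrow>
     real^'n \<Rightarrow> real^'m \<Rightarrow> bool" where
  "eps_primal_dual f h A b \<epsilon> x lam \<longleftrightarrow>
     (\<exists>g\<in>subdifferential h x. norm (g + grad f x + transpose A *v lam) \<le> \<epsilon>) \<and>
     norm (A *v x - b) \<le> \<epsilon>"


section \<open>ACG\<close>

text \<open>
  The state before iteration \<open>j\<close> holds \<open>S\<^sub>j\<close>, \<open>\<tau>\<^sub>j\<close>, \<open>p\<^sub>j\<close> and \<open>q\<^sub>j\<close>.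
\<close>
datatype 'a acg_state =
  Acg_State (acg_S: real) (acg_tau: real) (acg_p: 'a) (acg_q: 'a)

definition acg_s :: "real \<Rightarrow> 'a acg_state \<Rightarrow> real" where
  "acg_s L st =
     (acg_tau st + sqrt ((acg_tau st)\<^sup>2 + 8 * acg_tau st * acg_S st * L)) / (4 * L)"

definition acg_p_tilde :: "real \<Rightarrow> 'a::real_inner acg_state \<Rightarrow> 'a" where
  "acg_p_tilde L st =
     (let s = acg_s L st; S' = acg_S st + s
      in (acg_S st / S') *\<^sub>R acg_q st + (s / S') *\<^sub>R acg_p st)"

definition acg_q_tilde ::
    "('a::real_inner \<Rightarrow> real) \<Rightarrow> ('a \<Rightarrow> ereal) \<Rightarrow> real \<Rightarrow> real \<Rightarrow> 'a acg_state \<Rightarrow> 'a" where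
  "acg_q_tilde g h L \<mu> st =
     (let pt = acg_p_tilde L st
      in arg_min (\<lambda>u. ereal (g pt + grad g pt \<bullet> (u - pt)) + h u
                      + ereal ((2 * L + \<mu>) / 2 * (norm (u - pt))\<^sup>2)) (\<lambda>_. True))"

text \<open>
  The next \<open>q\<close> is a point of \<open>{q\<^sub>j, q~\<^sub>j\<^sub>+\<^sub>1}\<close> with the smaller value of \<open>\<psi> = g + h\<close>. The
  algorithm leaves the choice open when the values agree; the flag \<open>t\<close> makes it, and results
  are to be stated for all sequences of flags.
\<close>
definition acg_step ::
    "('a::real_inner \<Rightarrow> real) \<Rightarrow> ('a \<Rightarrow> ereal) \<Rightarrow> real \<Rightarrow> real \<Rightarrow> bool \<Rightarrow>
     'a acg_state \<Rightarrow> 'a acg_state" where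
  "acg_step g h L \<mu> t st =
     (let s = acg_s L st; S = acg_S st; S' = S + s;
          q = acg_q st; qt = acg_q_tilde g h L \<mu> st;
          \<psi> = (\<lambda>u. ereal (g u) + h u)
      in Acg_State
           S'
           (acg_tau st + \<mu> * s)
           ((1 / (S' * \<mu> + 1)) *\<^sub>R (((2 * L + \<mu>) * s) *\<^sub>R qt - (2 * S * s * L / S') *\<^sub>R q))
           (if \<psi> qt < \<psi> q \<or> (\<psi> qt = \<psi> q \<and> t) then qt else q))"

primrec acg ::
    "('a::real_inner \<Rightarrow> real) \<Rightarrow> ('a \<Rightarrow> ereal) \<Rightarrow> real \<Rightarrow> real \<Rightarrow> (nat \<Rightarrow> bool) \<Rightarrow> 'a \<Rightarrow>
     nat \<Rightarrow> 'a acg_state" where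
  "acg g h L \<mu> t p0 0 = Acg_State 0 1 p0 p0"
| "acg g h L \<mu> t p0 (Suc j) = acg_step g h L \<mu> (t j) (acg g h L \<mu> t p0 j)"


section \<open>I-ALM\<close>

text \<open>
  \<open>t k j\<close> breaks a possible tie in iteration \<open>j\<close> of the ACG call of outer iteration \<open>k\<close>.
\<close>
locale ialm =
  fixes f :: "real^'n \<Rightarrow> real" and h :: "real^'n \<Rightarrow> ereal"
    and A :: "real^'n^'m" and b :: "real^'m"
    and Lf D :: real
    and x0 :: "real^'n"
    and \<rho> \<epsilon>0 \<alpha> \<epsilon> \<sigma> :: real
    and t :: "nat \<Rightarrow> nat \<Rightarrow> bool"
begin

definition eps :: "nat \<Rightarrow> real" where
  "eps k = (\<epsilon>0 * \<alpha> ^ k + \<sigma> * \<rho> * \<epsilon>\<^sup>2) / 2"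

definition smooth_part :: "real^'m \<Rightarrow> real^'n \<Rightarrow> real" where
  "smooth_part lam x =
     f x + lam \<bullet> (A *v x - b) + \<rho> / 2 * (norm (A *v x - b))\<^sup>2"

definition M :: real where
  "M = Lf + \<rho> * (spectral_norm A)\<^sup>2"

definition mu :: "nat \<Rightarrow> real" where
  "mu k = eps k / (4 * D\<^sup>2)"

definition stepsize :: "nat \<Rightarrow> real" where
  "stepsize k = inverse (2 * M + mu k)"

definition G :: "nat \<Rightarrow> real^'m \<Rightarrow> real^'n \<Rightarrow> real^'n" where
  "G k lam x = grad_map (stepsize k) (smooth_part lam) h x"

text \<open>In what follows \<open>x\<close> and \<open>lam\<close> are the iterates at the start of outer iteration \<open>k\<close>.\<close>

definition acg_point :: "nat \<Rightarrow> real^'n \<Rightarrow> real^'m \<Rightarrow> nat \<Rightarrow> real^'n" where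
  "acg_point k x lam j =
     acg_p_tilde M
       (acg (\<lambda>u. smooth_part lam u + eps k / (8 * D\<^sup>2) * (norm (u - x))\<^sup>2) h M (mu k) (t k) x j)"

definition acg_stop :: "nat \<Rightarrow> real^'n \<Rightarrow> real^'m \<Rightarrow> nat \<Rightarrow> bool" where
  "acg_stop k x lam j \<longleftrightarrow> norm (G k lam (acg_point k x lam j)) \<le> eps k / (2 * D)"

definition acg_last :: "nat \<Rightarrow> real^'n \<Rightarrow> real^'m \<Rightarrow> nat" where
  "acg_last k x lam = (LEAST j. acg_stop k x lam j)"

definition x_tilde :: "nat \<Rightarrow> real^'n \<Rightarrow> real^'m \<Rightarrow> real^'n" where
  "x_tilde k x lam = acg_point k x lam (acg_last k x lam)"

definition x_next :: "nat \<Rightarrow> real^'n \<Rightarrow> real^'m \<Rightarrow> real^'n" where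
  "x_next k x lam = x_tilde k x lam - stepsize k *\<^sub>R G k lam (x_tilde k x lam)"

definition lam_next :: "nat \<Rightarrow> real^'n \<Rightarrow> real^'m \<Rightarrow> real^'m" where
  "lam_next k x lam = lam + \<rho> *\<^sub>R (A *v x_next k x lam - b)"

definition outer_stop :: "nat \<Rightarrow> real^'n \<Rightarrow> real^'m \<Rightarrow> bool" where
  "outer_stop k x lam \<longleftrightarrow>
     norm (G k lam (x_tilde k x lam)) \<le> \<epsilon> / 2 \<and> norm (A *v x_next k x lam - b) \<le> \<epsilon>"

primrec iterate :: "nat \<Rightarrow> (real^'n) \<times> (real^'m)" where
  "iterate 0 = (x0, 0)"
| "iterate (Suc k) =
     (x_next k (fst (iterate k)) (snd (iterate k)), lam_next k (fst (iterate k)) (snd (iterate k)))"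

text \<open>
  I-ALM returns \<open>(x, lam)\<close> in outer iteration \<open>K\<close>, after \<open>N\<close> ACG iterations in total. That
  every ACG call up to \<open>K\<close> stops is required explicitly, because \<open>LEAST\<close> in \<open>acg_last\<close> is
  meaningless for a call that does not. A call that stops with the point of iteration \<open>j\<close>
  has used the \<open>j + 1\<close> iterations \<open>0, \<dots>, j\<close>.
\<close>
definition returns :: "nat \<Rightarrow> real^'n \<Rightarrow> real^'m \<Rightarrow> bool" where
  "returns N x lam \<longleftrightarrow>
     (\<exists>K. (\<forall>k\<le>K. \<exists>j. acg_stop k (fst (iterate k)) (snd (iterate k)) j) \<and>
          (\<forall>k<K. \<not> outer_stop k (fst (iterate k)) (snd (iterate k))) \<and>
          outer_stop K (fst (iterate K)) (snd (iterate K)) \<and>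
          N = (\<Sum>k\<le>K. (acg_last k (fst (iterate k)) (snd (iterate k)) + 1)) \<and>
          (x, lam) = iterate (Suc K))"

end


section \<open>The factors suppressed by the soft-O notation\<close>

text \<open>
  The dimensions are types here, so a bound of the form ``there is a constant such that for all
  problems'' would permit a different constant for each pair of dimensions. The factor that the
  soft-O notation hides is therefore written as a closed term: one constant depending only on
  \<open>\<alpha>\<close>, whose numerical value is immaterial, and one logarithm in the problem parameters.
\<close>
definition soft_O_const :: "real \<Rightarrow> real" where
  "soft_O_const \<alpha> = 10 ^ 4 / (1 - \<alpha>)"

definition soft_O_log :: "real \<Rightarrow> real \<Rightarrow> real \<Rightarrow> real \<Rightarrow> real" where
  "soft_O_log Lf normA D \<epsilon> = ln (2 + Lf + normA + D + 1 / \<epsilon>)"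

end

theory Submission
  imports Defs
begin

text \<open>
  Each ACG call is governed by the potential \<open>S\<^sub>j (\<psi>(q\<^sub>j) - \<psi>(u)) + \<tau>\<^sub>j / 2 \<parallel>p\<^sub>j - u\<parallel>\<^sup>2\<close>, which does not increase.
  At the minimizer of \<open>\<psi>\<close> it forces \<open>p~\<^sub>j\<close> to converge linearly, and since the gradient mapping is
  Lipschitz and the regularization contributes at most half of the tolerance to it, the call stops
  after about \<open>sqrt (M / \<mu>)\<close> iterations, up to a logarithm. The starting gap never enters, only the
  diameter of the domain.

  A multiplier update is an inexact proximal step on the dual, so for every dual maximizer
  \<open>\<lambda>\<close> the squared steps sum to at most \<open>\<parallel>\<lambda>\<parallel>\<^sup>2\<close> plus the accumulated errors. As \<open>\<rho> \<epsilon> = 1\<close>, an outer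
  iteration that leaves the constraint violated by more than \<open>\<epsilon>\<close> makes a step longer than one, while
  the errors account for only \<open>3 / 8\<close> per iteration plus a geometric series.
\<close>

section \<open>Extended-real-valued convex functions\<close>

text \<open>The test that ends an ACG call examines the gradient mapping of the unregularized
  \<open>smooth_part lam\<close> at p~_j, whereas the potential controls q_j through objective
  values and p_j through distances. Distance to the regularized minimizer is the common currency:
  strong convexity converts the objective gap at q_j, and p~_j lies between q_j and p_j. The modulus
  \<open>M\<close> does not involve the multiplier, and for the parameters of the theorem
  \<open>eps k\<close> is at least a quarter of \<epsilon>, so one count serves all calls.

  The 3/8 arises as follows. A call leaves a residual of at most \<open>eps k / (2 * D)\<close>; at
  the next iterate it may have grown by the factor 3/2; times the diameter, this iterate minimizes
  the Lagrangian at the new multiplier up to \<open>3 / 4 * eps k\<close>; the proximal identity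
  doubles this and multiplies it by \<rho>. For the chosen parameters
  \<open>3 / 2 * (\<rho> * eps k)\<close> is \<open>3 / 4 * \<alpha> ^ k + 3 / 8\<close>, so an
  outer iteration that does not stop gains at least 5/8 apart from the summable part.\<close>

lemma proper_ereal_real:
  assumes "proper_closed_convex h" "x \<in> ext_dom h"
  shows "h x = ereal (real_of_ereal (h x))"
  using assms unfolding proper_closed_convex_def ext_dom_def
  by (cases "h x") auto

lemma notin_ext_dom: "x \<notin> ext_dom h \<longleftrightarrow> h x = \<infinity>"
  by (simp add: ext_dom_def)

lemma ext_dom_nonempty: "proper_closed_convex h \<Longrightarrow> ext_dom h \<noteq> {}"
  unfolding proper_closed_convex_def ext_dom_def by auto

lemma convex_on_ext_dom:
  assumes h: "proper_closed_convex h"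
  shows "convex_on (ext_dom h) (\<lambda>x. real_of_ereal (h x))"
proof -
  have key: "h (u *\<^sub>R x + v *\<^sub>R y) \<le> ereal (u * real_of_ereal (h x) + v * real_of_ereal (h y))"
    if "x \<in> ext_dom h" "y \<in> ext_dom h" "0 \<le> u" "0 \<le> v" "u + v = 1" for x y u v
  proof -
    have "convex (ext_epigraph h)" using h by (simp add: proper_closed_convex_def)
    moreover have "(x, real_of_ereal (h x)) \<in> ext_epigraph h" "(y, real_of_ereal (h y)) \<in> ext_epigraph h"
      using proper_ereal_real[OF h] that by (auto simp: ext_epigraph_def)
    ultimately have "u *\<^sub>R (x, real_of_ereal (h x)) + v *\<^sub>R (y, real_of_ereal (h y)) \<in> ext_epigraph h"
      using that unfolding convex_def by blast
    then show ?thesis by (simp add: ext_epigraph_def)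
  qed
  have "convex (ext_dom h)"
    unfolding convex_def
  proof (intro ballI allI impI)
    fix x y and u v :: real
    assume "x \<in> ext_dom h" "y \<in> ext_dom h" "0 \<le> u" "0 \<le> v" "u + v = 1"
    from key[OF this] show "u *\<^sub>R x + v *\<^sub>R y \<in> ext_dom h"
      unfolding ext_dom_def by (auto intro: le_less_trans)
  qed
  moreover have "real_of_ereal (h (u *\<^sub>R x + v *\<^sub>R y)) \<le> u * real_of_ereal (h x) + v * real_of_ereal (h y)"
    if "x \<in> ext_dom h" "y \<in> ext_dom h" "0 \<le> u" "0 \<le> v" "u + v = 1" for x y u v
  proof -
    have "u *\<^sub>R x + v *\<^sub>R y \<in> ext_dom h"
      using \<open>convex (ext_dom h)\<close> that unfolding convex_def by blast
    from key[OF that] proper_ereal_real[OF h this] show ?thesis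
      by (metis ereal_less_eq(3))
  qed
  ultimately show ?thesis unfolding convex_on_def by blast
qed

lemma convex_ext_dom: "proper_closed_convex h \<Longrightarrow> convex (ext_dom h)"
  using convex_on_ext_dom convex_on_imp_convex by blast

lemma convex_on_of_ereal:
  assumes "proper_closed_convex (\<lambda>x. ereal (f x))"
  shows "convex_on UNIV f"
  using convex_on_ext_dom[OF assms] by (simp add: ext_dom_def)

section \<open>Existence of minimizers over a bounded domain\<close>

lemma closed_sublevel:
  assumes h: "proper_closed_convex h"
  shows "closed {x. h x \<le> ereal r}"
proof -
  have "{x. h x \<le> ereal r} = (\<lambda>x. (x, r)) -` ext_epigraph h"
    by (auto simp: ext_epigraph_def)
  moreover have "closed (ext_epigraph h)" using h by (simp add: proper_closed_convex_def)
  ultimately show ?thesis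
    by (simp add: continuous_closed_vimage continuous_intros)
qed

text \<open>The sublevel sets at -n are compact and nested; were all of them nonempty, a common
  point would have the value -\<infinity>, which properness forbids.\<close>

lemma bounded_below_ext_dom:
  fixes h :: "'a::euclidean_space \<Rightarrow> ereal"
  assumes h: "proper_closed_convex h" and bdd: "bounded (ext_dom h)"
  obtains m where "\<And>x. ereal m \<le> h x"
proof -
  have "\<exists>n::nat. {x. h x \<le> ereal (- real n)} = {}"
  proof (rule ccontr)
    assume ne: "\<not> ?thesis"
    have "compact {x. h x \<le> ereal (- real n)}" for n
    proof -
      have "{x. h x \<le> ereal (- real n)} \<subseteq> ext_dom h"
        by (auto simp: ext_dom_def intro: le_less_trans)
      then show ?thesis
        using closed_sublevel[OF h] bounded_subset[OF bdd] by (simp add: compact_eq_bounded_closed)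
    qed
    then have "\<Inter>(range (\<lambda>n::nat. {x. h x \<le> ereal (- real n)})) \<noteq> {}"
      using ne by (intro compact_nest) (auto intro: order_trans)
    then obtain x where x: "\<And>n::nat. h x \<le> ereal (- real n)" by auto
    show False
    proof (cases "h x")
      case (real r)
      obtain n :: nat where "- r < real n" using reals_Archimedean2 by blast
      then show ?thesis using x[of n] real by simp
    next
      case PInf
      then show ?thesis using x[of 0] by simp
    next
      case MInf
      then show ?thesis using h by (auto simp: proper_closed_convex_def)
    qed
  qed
  then obtain n :: nat where "{x. h x \<le> ereal (- real n)} = {}" by blast
  then have "ereal (- real n) \<le> h x" for x by (metis (mono_tags) empty_Collect_eq linear)
  then show ?thesis using that by blast
qed

text \<open>Since \<open>h\<close> is only lower semicontinuous, the continuous function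
  \<open>s (fst p) + snd p\<close> is minimized instead, over a compact piece of the closed
  epigraph. \<open>T\<close> is the whole space for the steps of the algorithm and the feasible set
  for duality.\<close>

lemma composite_attains_inf:
  fixes h :: "'a::euclidean_space \<Rightarrow> ereal" and s :: "'a \<Rightarrow> real"
  assumes h: "proper_closed_convex h" and bdd: "bounded (ext_dom h)"
    and s: "continuous_on UNIV s" and T: "closed T" and ne: "ext_dom h \<inter> T \<noteq> {}"
  obtains x where "x \<in> ext_dom h \<inter> T"
    "\<And>y. y \<in> ext_dom h \<inter> T \<Longrightarrow> s x + real_of_ereal (h x) \<le> s y + real_of_ereal (h y)"
proof -
  obtain m where m: "\<And>x. ereal m \<le> h x" using bounded_below_ext_dom[OF h bdd] by blast
  obtain z where z: "z \<in> ext_dom h" "z \<in> T" using ne by blast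
  have "compact (closure (ext_dom h))" using bdd by simp
  moreover have "continuous_on (closure (ext_dom h)) s" using s continuous_on_subset by blast
  ultimately obtain B where B: "\<And>x. x \<in> closure (ext_dom h) \<Longrightarrow> norm (s x) \<le> B"
    using compact_continuous_image compact_imp_bounded by (metis bounded_iff image_eqI)
  \<comment> \<open>Cutting the epigraph at height \<open>R\<close> loses no minimizer: if
    \<open>h y\<close> exceeds \<open>R\<close>, then \<open>s y + h y\<close> is above
    \<open>B + h z\<close>, hence above the value at \<open>z\<close>.\<close>
  define R where "R = 2 * B + real_of_ereal (h z)"
  define E where "E = ext_epigraph h \<inter> (T \<times> {..R})"
  have hdom: "(x, r) \<in> ext_epigraph h \<Longrightarrow> x \<in> ext_dom h" for x r
    by (auto simp: ext_epigraph_def ext_dom_def intro: le_less_trans)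
  have Esub: "E \<subseteq> ext_dom h \<times> {m..R}"
  proof
    fix p assume "p \<in> E"
    then obtain x r where p: "p = (x, r)" "h x \<le> ereal r" "r \<le> R"
      by (auto simp: E_def ext_epigraph_def)
    have "ereal m \<le> ereal r" using p(2) m order_trans by blast
    then show "p \<in> ext_dom h \<times> {m..R}" using p hdom by (auto simp: ext_epigraph_def)
  qed
  have "closed E" unfolding E_def using h T
    by (auto simp: proper_closed_convex_def intro!: closed_Int closed_Times)
  moreover have "bounded E" using Esub bdd bounded_Times bounded_closed_interval bounded_subset by metis
  ultimately have "compact E" by (simp add: compact_eq_bounded_closed)
  moreover have zE: "(z, real_of_ereal (h z)) \<in> E"
    using z proper_ereal_real[OF h z(1)] B[of z] closure_subset[of "ext_dom h"]
    by (fastforce simp: E_def ext_epigraph_def R_def)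
  moreover have "continuous_on E (\<lambda>p. s (fst p) + snd p)"
    by (intro continuous_intros continuous_on_compose2[OF s]) auto
  ultimately obtain p where p: "p \<in> E" "\<And>q. q \<in> E \<Longrightarrow> s (fst p) + snd p \<le> s (fst q) + snd q"
    using continuous_attains_inf[of E] by blast
  obtain x r where xr: "p = (x, r)" by fastforce
  have x: "x \<in> ext_dom h" "x \<in> T" "h x \<le> ereal r"
    using p(1) xr hdom by (auto simp: E_def ext_epigraph_def)
  have hx: "real_of_ereal (h x) \<le> r"
    using x(3) proper_ereal_real[OF h x(1)] by (metis ereal_less_eq(3))
  have "s x + real_of_ereal (h x) \<le> s y + real_of_ereal (h y)" if y: "y \<in> ext_dom h \<inter> T" for y
  proof (cases "real_of_ereal (h y) \<le> R")
    case True
    then have "(y, real_of_ereal (h y)) \<in> E"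
      using y proper_ereal_real[OF h, of y] by (auto simp: E_def ext_epigraph_def)
    from p(2)[OF this] show ?thesis using hx xr by simp
  next
    case False
    have "\<bar>s z\<bar> \<le> B" "\<bar>s y\<bar> \<le> B" using B z y closure_subset[of "ext_dom h"] by fastforce+
    then have "s z + real_of_ereal (h z) \<le> s y + real_of_ereal (h y)"
      using False by (simp add: R_def)
    moreover have "s x + r \<le> s z + real_of_ereal (h z)" using p(2)[OF zE] xr by simp
    ultimately show ?thesis using hx by linarith
  qed
  with x that show ?thesis by blast
qed

text \<open>\<open>arg_min\<close> is a choice operator, so its value means nothing until a
  minimizer exists. The weight \<open>c\<close> covers both uses: \<eta> for \<open>prox\<close> and
  1 for \<open>acg_q_tilde\<close>.\<close>

lemma arg_min_composite:
  fixes h :: "'a::euclidean_space \<Rightarrow> ereal" and s :: "'a \<Rightarrow> real"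
  assumes h: "proper_closed_convex h" and bdd: "bounded (ext_dom h)"
    and s: "continuous_on UNIV s" and c: "0 < c"
    and F: "\<And>y. y \<in> ext_dom h \<Longrightarrow> F y = ereal (s y + c * real_of_ereal (h y))"
    and F': "\<And>y. y \<notin> ext_dom h \<Longrightarrow> F y = \<infinity>"
  shows "arg_min F (\<lambda>_. True) \<in> ext_dom h"
    "y \<in> ext_dom h \<Longrightarrow> s (arg_min F (\<lambda>_. True)) + c * real_of_ereal (h (arg_min F (\<lambda>_. True)))
       \<le> s y + c * real_of_ereal (h y)"
proof -
  let ?m = "arg_min F (\<lambda>_. True)"
  obtain x where x: "x \<in> ext_dom h"
    "\<And>y. y \<in> ext_dom h \<Longrightarrow> s x / c + real_of_ereal (h x) \<le> s y / c + real_of_ereal (h y)"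
  proof (rule composite_attains_inf[OF h bdd, of "\<lambda>x. s x / c" UNIV])
    show "continuous_on UNIV (\<lambda>x. s x / c)" using s c by (intro continuous_intros) auto
  qed (use ext_dom_nonempty[OF h] in auto)
  have "F x \<le> F y" for y
  proof (cases "y \<in> ext_dom h")
    case True
    have "c * (s x / c + real_of_ereal (h x)) \<le> c * (s y / c + real_of_ereal (h y))"
      using x(2)[OF True] c by simp
    then show ?thesis using F[OF True] F[OF x(1)] c by (simp add: distrib_left)
  qed (simp add: F')
  then have "is_arg_min F (\<lambda>_. True) x" by (simp add: is_arg_min_linorder)
  then have "is_arg_min F (\<lambda>_. True) ?m" unfolding arg_min_def by (rule someI)
  then have m: "\<And>y. F ?m \<le> F y" by (simp add: is_arg_min_linorder)
  show md: "?m \<in> ext_dom h"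
  proof (rule ccontr)
    assume "?m \<notin> ext_dom h"
    then show False using m[of x] F[OF x(1)] F'[of ?m] by simp
  qed
  show "s ?m + c * real_of_ereal (h ?m) \<le> s y + c * real_of_ereal (h y)" if "y \<in> ext_dom h"
    using m[of y] F[OF md] F[OF that] by simp
qed

section \<open>Subgradient optimality and the proximal map\<close>

lemma proximal_optimality:
  fixes h :: "'a::real_inner \<Rightarrow> ereal"
  assumes h: "proper_closed_convex h" and x: "x \<in> ext_dom h" and y: "y \<in> ext_dom h"
    and min: "\<And>y. y \<in> ext_dom h \<Longrightarrow>
      a \<bullet> x + c / 2 * (norm (x - z))\<^sup>2 + real_of_ereal (h x) \<le> a \<bullet> y + c / 2 * (norm (y - z))\<^sup>2 + real_of_ereal (h y)"
  shows "real_of_ereal (h x) + (c *\<^sub>R (z - x) - a) \<bullet> (y - x) \<le> real_of_ereal (h y)"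
proof -
  let ?h = "\<lambda>x. real_of_ereal (h x)"
  \<comment> \<open>Moving from \<open>x\<close> towards \<open>y\<close> by a fraction
    \<open>e\<close> changes the quadratic by a linear term plus order \<open>e\<^sup>2\<close>;
    after division by \<open>e\<close> the latter vanishes as \<open>e\<close> tends to 0.\<close>
  have ineq: "?h x + (c *\<^sub>R (z - x) - a) \<bullet> (y - x) \<le> ?h y + e * (c / 2 * (norm (y - x))\<^sup>2)"
    if e: "0 < e" "e < 1" for e
  proof -
    let ?w = "x + e *\<^sub>R (y - x)"
    have w: "?w = (1 - e) *\<^sub>R x + e *\<^sub>R y" by (simp add: algebra_simps)
    have "?w \<in> ext_dom h" using convex_ext_dom[OF h] x y e unfolding w convex_def by simp
    note m = min[OF this]
    have hw: "?h ?w \<le> (1 - e) * ?h x + e * ?h y"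
      using convex_onD[OF convex_on_ext_dom[OF h], of e x y] e x y unfolding w by simp
    have sq: "(norm (?w - z))\<^sup>2 = (norm (x - z))\<^sup>2 + e * (2 * ((x - z) \<bullet> (y - x))) + e\<^sup>2 * (norm (y - x))\<^sup>2"
      unfolding power2_norm_eq_inner by (simp add: inner_simps inner_commute power2_eq_square algebra_simps)
    have "0 \<le> e * (a \<bullet> (y - x) + c * ((x - z) \<bullet> (y - x)) + e * (c / 2 * (norm (y - x))\<^sup>2) + (?h y - ?h x))"
      using m hw unfolding sq by (simp add: inner_simps algebra_simps power2_eq_square)
    then have "0 \<le> a \<bullet> (y - x) + c * ((x - z) \<bullet> (y - x)) + e * (c / 2 * (norm (y - x))\<^sup>2) + (?h y - ?h x)"
      using e by (simp add: zero_le_mult_iff)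
    then show ?thesis by (simp add: inner_simps algebra_simps)
  qed
  have "((\<lambda>e. ?h y + e * (c / 2 * (norm (y - x))\<^sup>2)) \<longlongrightarrow> ?h y + 0 * (c / 2 * (norm (y - x))\<^sup>2)) (at_right 0)"
    by (intro tendsto_intros)
  moreover have "\<forall>\<^sub>F e in at_right 0. ?h x + (c *\<^sub>R (z - x) - a) \<bullet> (y - x) \<le> ?h y + e * (c / 2 * (norm (y - x))\<^sup>2)"
    using eventually_at_right_less[of 0] eventually_at_right[of "0::real" 1] ineq
    by (metis (no_types, lifting) zero_less_one)
  ultimately show ?thesis
    using tendsto_lowerbound[of "\<lambda>e. ?h y + e * (c / 2 * (norm (y - x))\<^sup>2)"] by force
qed

lemma subdifferential_iff:
  assumes h: "proper_closed_convex h" and x: "x \<in> ext_dom h"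
  shows "g \<in> subdifferential h x \<longleftrightarrow>
    (\<forall>y\<in>ext_dom h. real_of_ereal (h x) + g \<bullet> (y - x) \<le> real_of_ereal (h y))"
proof -
  have "h x + ereal (g \<bullet> (y - x)) \<le> h y \<longleftrightarrow>
      (y \<in> ext_dom h \<longrightarrow> real_of_ereal (h x) + g \<bullet> (y - x) \<le> real_of_ereal (h y))" for y
  proof (cases "y \<in> ext_dom h")
    case True
    obtain r s where "h x = ereal r" "h y = ereal s"
      using proper_ereal_real[OF h x] proper_ereal_real[OF h True] by blast
    then show ?thesis using True by simp
  next
    case False
    then show ?thesis by (simp add: notin_ext_dom[symmetric] notin_ext_dom[THEN iffD1])
  qed
  then show ?thesis by (auto simp: subdifferential_def)
qed

lemma prox_mem_subdifferential:
  fixes h :: "'a::euclidean_space \<Rightarrow> ereal"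
  assumes h: "proper_closed_convex h" and bdd: "bounded (ext_dom h)" and "0 < \<eta>"
  shows "prox \<eta> h z \<in> ext_dom h"
    and "(1 / \<eta>) *\<^sub>R (z - prox \<eta> h z) \<in> subdifferential h (prox \<eta> h z)"
proof -
  let ?s = "\<lambda>y. (norm (z - y))\<^sup>2 / 2"
  have F: "ereal \<eta> * h y + ereal (?s y) = ereal (?s y + \<eta> * real_of_ereal (h y))" if "y \<in> ext_dom h" for y
    by (subst proper_ereal_real[OF h that]) simp
  have F': "ereal \<eta> * h y + ereal (?s y) = \<infinity>" if "y \<notin> ext_dom h" for y
    using that \<open>0 < \<eta>\<close> by (simp add: notin_ext_dom)
  have s: "continuous_on UNIV ?s" by (intro continuous_intros) auto
  have p: "?s (prox \<eta> h z) + \<eta> * real_of_ereal (h (prox \<eta> h z)) \<le> ?s u + \<eta> * real_of_ereal (h u)"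
    if "u \<in> ext_dom h" for u
    unfolding prox_def by (rule arg_min_composite(2)[OF h bdd s \<open>0 < \<eta>\<close> F F' that])
  show dom: "prox \<eta> h z \<in> ext_dom h"
    unfolding prox_def by (rule arg_min_composite(1)[OF h bdd s \<open>0 < \<eta>\<close> F F'])
  show "(1 / \<eta>) *\<^sub>R (z - prox \<eta> h z) \<in> subdifferential h (prox \<eta> h z)"
    unfolding subdifferential_iff[OF h dom]
  proof
    fix y assume y: "y \<in> ext_dom h"
    have "0 \<bullet> prox \<eta> h z + (1 / \<eta>) / 2 * (norm (prox \<eta> h z - z))\<^sup>2 + real_of_ereal (h (prox \<eta> h z))
       \<le> 0 \<bullet> u + (1 / \<eta>) / 2 * (norm (u - z))\<^sup>2 + real_of_ereal (h u)" if "u \<in> ext_dom h" for u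
      using divide_right_mono[OF p[OF that], of \<eta>] \<open>0 < \<eta>\<close>
      by (simp add: norm_minus_commute add_divide_distrib mult.commute)
    from proximal_optimality[OF h dom y this]
    show "real_of_ereal (h (prox \<eta> h z)) + (1 / \<eta>) *\<^sub>R (z - prox \<eta> h z) \<bullet> (y - prox \<eta> h z) \<le> real_of_ereal (h y)"
      by simp
  qed
qed

text \<open>Monotonicity of the subdifferential with Cauchy-Schwarz. That \<open>x\<close> is the
  proximal point of \<open>w\<close> is expressed by a subgradient, the form in which the minimizer
  of the regularized subproblem supplies it.\<close>

lemma prox_nonexpansive:
  fixes h :: "'a::euclidean_space \<Rightarrow> ereal"
  assumes h: "proper_closed_convex h" and bdd: "bounded (ext_dom h)" and "0 < \<eta>"
    and x: "x \<in> ext_dom h" and v: "(1 / \<eta>) *\<^sub>R (w - x) \<in> subdifferential h x"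
  shows "norm (prox \<eta> h z - x) \<le> norm (z - w)"
proof -
  let ?p = "prox \<eta> h z"
  note p = prox_mem_subdifferential[OF h bdd \<open>0 < \<eta>\<close>, of z]
  have "real_of_ereal (h ?p) + (1 / \<eta>) *\<^sub>R (z - ?p) \<bullet> (x - ?p) \<le> real_of_ereal (h x)"
    using p x by (simp add: subdifferential_iff[OF h p(1)])
  moreover have "real_of_ereal (h x) + (1 / \<eta>) *\<^sub>R (w - x) \<bullet> (?p - x) \<le> real_of_ereal (h ?p)"
    using p x v by (simp add: subdifferential_iff[OF h x])
  ultimately have "(1 / \<eta>) *\<^sub>R (z - ?p) \<bullet> (x - ?p) + (1 / \<eta>) *\<^sub>R (w - x) \<bullet> (?p - x) \<le> 0" by linarith
  then have "(1 / \<eta>) * ((z - ?p) \<bullet> (x - ?p) + (w - x) \<bullet> (?p - x)) \<le> 0"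
    by (simp add: distrib_left)
  then have "(z - ?p) \<bullet> (x - ?p) + (w - x) \<bullet> (?p - x) \<le> 0"
    using \<open>0 < \<eta>\<close> by (simp add: divide_le_0_iff)
  then have "(norm (?p - x))\<^sup>2 \<le> (z - w) \<bullet> (?p - x)"
    unfolding power2_norm_eq_inner by (simp add: inner_simps inner_commute)
  also have "\<dots> \<le> norm (z - w) * norm (?p - x)" by (rule norm_cauchy_schwarz)
  finally show ?thesis
    by (cases "?p = x") (auto simp: power2_eq_square)
qed

section \<open>Accelerated composite gradient\<close>

text \<open>A minimizer of \<open>g + h\<close> also minimizes \<open>h\<close> plus the quadratic upper model of \<open>g\<close> at the
  minimizer.\<close>
lemma composite_minimizer:
  fixes h :: "'a::euclidean_space \<Rightarrow> ereal"
  assumes h: "proper_closed_convex h" and bdd: "bounded (ext_dom h)" and g: "continuous_on UNIV g"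
    and upper: "\<And>x y. g y \<le> g x + g' x \<bullet> (y - x) + \<kappa> / 2 * (norm (y - x))\<^sup>2"
  obtains x where "x \<in> ext_dom h" "- g' x \<in> subdifferential h x"
proof -
  obtain x where x: "x \<in> ext_dom h"
    "\<And>y. y \<in> ext_dom h \<Longrightarrow> g x + real_of_ereal (h x) \<le> g y + real_of_ereal (h y)"
    using composite_attains_inf[OF h bdd g closed_UNIV] ext_dom_nonempty[OF h] by auto
  have "g' x \<bullet> x + \<kappa> / 2 * (norm (x - x))\<^sup>2 + real_of_ereal (h x)
      \<le> g' x \<bullet> y + \<kappa> / 2 * (norm (y - x))\<^sup>2 + real_of_ereal (h y)" if "y \<in> ext_dom h" for y
    using x(2)[OF that] upper[of y x] by (simp add: inner_diff_right)
  from proximal_optimality[OF h x(1) _ this] have "- g' x \<in> subdifferential h x"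
    by (simp add: subdifferential_iff[OF h x(1)])
  with x that show ?thesis by blast
qed

text \<open>\<open>acg_s\<close> is the positive root of
  \<open>2 * L * s\<^sup>2 - \<tau> * s - \<tau> * S = 0\<close>; the induction steps use this
  equation instead of the formula.\<close>

lemma acg_s_properties:
  assumes "0 < L" "0 \<le> acg_S st" "0 < acg_tau st"
  shows "0 < acg_s L st" "2 * L * (acg_s L st)\<^sup>2 = acg_tau st * (acg_S st + acg_s L st)"
proof -
  let ?r = "(acg_tau st)\<^sup>2 + 8 * acg_tau st * acg_S st * L"
  have r: "0 \<le> ?r" using assms by simp
  show "0 < acg_s L st" unfolding acg_s_def using assms r by (simp add: add_pos_nonneg)
  have "4 * L * acg_s L st - acg_tau st = sqrt ?r" using assms by (simp add: acg_s_def)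
  then have "(4 * L * acg_s L st - acg_tau st)\<^sup>2 = ?r" using r by simp
  then have "8 * L * (2 * L * (acg_s L st)\<^sup>2) = 8 * L * (acg_tau st * (acg_S st + acg_s L st))"
    by (simp add: power2_eq_square algebra_simps)
  then show "2 * L * (acg_s L st)\<^sup>2 = acg_tau st * (acg_S st + acg_s L st)" using assms by simp
qed

text \<open>The estimate-sequence inequality, in coordinates centred at the prox point: \<open>a\<close>, \<open>v\<close>, \<open>r\<close>,
  \<open>e\<close>, \<open>w\<close> are the offsets of \<open>q\<^sub>j\<close>, the comparison point, \<open>p\<^sub>j\<close>, \<open>p~\<^sub>j\<close> and \<open>p\<^sub>j\<^sub>+\<^sub>1\<close>.\<close>
lemma estimate_sequence_inequality:
  fixes a v r e w :: "'a::real_inner"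
  assumes "0 \<le> S" "0 \<le> \<mu>" "0 < \<tau>" "0 < s"
    and e: "(S + s) *\<^sub>R e = S *\<^sub>R a + s *\<^sub>R r"
    and s: "2 * L * s\<^sup>2 = \<tau> * (S + s)"
    and w: "(\<tau> + \<mu> * s) *\<^sub>R w = \<tau> *\<^sub>R r - (2 * L * s) *\<^sub>R e"
  shows "(\<tau> + \<mu> * s) / 2 * (norm (v - w))\<^sup>2 + (S + s) * (L * (norm e)\<^sup>2)
     \<le> S * (2 * L * (e \<bullet> a) + \<mu> / 2 * (norm a)\<^sup>2) + s * (2 * L * (e \<bullet> v) + \<mu> / 2 * (norm v)\<^sup>2)
        + \<tau> / 2 * (norm (v - r))\<^sup>2"
proof -
  let ?t = "\<tau> + \<mu> * s"
  have t: "\<tau> \<le> ?t" "0 < ?t" using assms by (auto simp: add_pos_nonneg)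
  have lin: "?t * (v \<bullet> w) = \<tau> * (v \<bullet> r) - 2 * L * s * (v \<bullet> e)"
    using arg_cong[OF w, of "\<lambda>x. v \<bullet> x"] by (simp add: inner_diff_right)
  have cen: "(S + s) * (e \<bullet> e) = S * (e \<bullet> a) + s * (e \<bullet> r)"
    using arg_cong[OF e, of "\<lambda>x. e \<bullet> x"] by (simp add: inner_add_right)
  have sq: "?t\<^sup>2 * (w \<bullet> w) = \<tau>\<^sup>2 * (r \<bullet> r) - 4 * \<tau> * L * s * (e \<bullet> r) + 4 * L\<^sup>2 * s\<^sup>2 * (e \<bullet> e)"
    using arg_cong2[OF w w, of "(\<bullet>)"]
    by (simp add: inner_diff_left inner_diff_right inner_commute power2_eq_square algebra_simps)
  \<comment> \<open>The squared update carries one factor \<open>?t\<close> too many. It is weakened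
    to \<tau>, and the equation for \<open>s\<close> lets \<tau> be factored out of the right side
    and cancelled.\<close>
  have "\<tau> * (?t * (w \<bullet> w)) \<le> ?t * (?t * (w \<bullet> w))"
    using t by (intro mult_right_mono mult_nonneg_nonneg) auto
  also have "\<dots> = \<tau>\<^sup>2 * (r \<bullet> r) - 4 * \<tau> * L * s * (e \<bullet> r) + 2 * L * (2 * L * s\<^sup>2) * (e \<bullet> e)"
    using sq by (simp add: power2_eq_square algebra_simps)
  also have "\<dots> = \<tau> * (\<tau> * (r \<bullet> r) - 4 * L * s * (e \<bullet> r) + 2 * L * ((S + s) * (e \<bullet> e)))"
    unfolding s by (simp add: power2_eq_square algebra_simps)
  finally have "?t * (w \<bullet> w) \<le> \<tau> * (r \<bullet> r) - 4 * L * s * (e \<bullet> r) + 2 * L * ((S + s) * (e \<bullet> e))"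
    using \<open>0 < \<tau>\<close> by simp
  also have "\<dots> = \<tau> * (r \<bullet> r) + 4 * L * (S * (e \<bullet> a)) - 2 * L * ((S + s) * (e \<bullet> e))"
    using cen by algebra
  finally have "?t * (w \<bullet> w) \<le> \<tau> * (r \<bullet> r) + 4 * L * (S * (e \<bullet> a)) - 2 * L * ((S + s) * (e \<bullet> e))" .
  moreover have "0 \<le> S * \<mu> * (a \<bullet> a)" using assms by simp
  moreover have "?t * ((v - w) \<bullet> (v - w)) = ?t * (v \<bullet> v) - 2 * (?t * (v \<bullet> w)) + ?t * (w \<bullet> w)"
    by (simp add: inner_simps inner_commute algebra_simps)
  moreover have "\<tau> * ((v - r) \<bullet> (v - r)) = \<tau> * (v \<bullet> v) - 2 * (\<tau> * (v \<bullet> r)) + \<tau> * (r \<bullet> r)"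
    by (simp add: inner_simps inner_commute algebra_simps)
  ultimately show ?thesis
    unfolding power2_norm_eq_inner using lin
    by (simp add: algebra_simps inner_commute add_divide_distrib)
qed

context
  fixes g :: "'a::euclidean_space \<Rightarrow> real" and h :: "'a \<Rightarrow> ereal" and L \<mu> :: real
  assumes h: "proper_closed_convex h" and bdd: "bounded (ext_dom h)"
    and L: "0 < L" and mu: "0 \<le> \<mu>"
    and lower: "\<And>x y. g x + grad g x \<bullet> (y - x) + \<mu> / 2 * (norm (y - x))\<^sup>2 \<le> g y"
    and upper: "\<And>x y. g y \<le> g x + grad g x \<bullet> (y - x) + (2 * L + \<mu>) / 2 * (norm (y - x))\<^sup>2"
begin

abbreviation (input) obj :: "'a \<Rightarrow> real" where
  "obj u \<equiv> g u + real_of_ereal (h u)"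

text \<open>All that a step needs of \<open>g\<close> and \<open>h\<close> is compressed into a
  quadratic minorant centred at \<open>qt\<close>, with value \<open>c\<close> there, and an upper
  bound for the objective at \<open>qt\<close>. The minorant joins the strongly convex lower bound
  of \<open>g\<close> at \<open>pt\<close> with the subgradient of \<open>h\<close> at
  \<open>qt\<close>.\<close>

lemma acg_q_tilde_model:
  fixes st
  defines "pt \<equiv> acg_p_tilde L st" and "qt \<equiv> acg_q_tilde g h L \<mu> st"
  shows "qt \<in> ext_dom h"
    and "\<exists>c. obj qt \<le> c + L * (norm (pt - qt))\<^sup>2 \<and>
      (\<forall>y\<in>ext_dom h. c + 2 * L * ((pt - qt) \<bullet> (y - qt)) + \<mu> / 2 * (norm (y - qt))\<^sup>2 \<le> obj y)"
proof -
  let ?s = "\<lambda>u. g pt + grad g pt \<bullet> (u - pt) + (2 * L + \<mu>) / 2 * (norm (u - pt))\<^sup>2"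
  let ?F = "\<lambda>u. ereal (g pt + grad g pt \<bullet> (u - pt)) + h u + ereal ((2 * L + \<mu>) / 2 * (norm (u - pt))\<^sup>2)"
  have F: "?F u = ereal (?s u + 1 * real_of_ereal (h u))" if "u \<in> ext_dom h" for u
    by (subst proper_ereal_real[OF h that]) simp
  have F': "?F u = \<infinity>" if "u \<notin> ext_dom h" for u
    using that by (simp add: notin_ext_dom)
  have s: "continuous_on UNIV ?s" by (intro continuous_intros)
  have qt: "qt = arg_min ?F (\<lambda>_. True)" by (simp add: qt_def acg_q_tilde_def pt_def Let_def)
  show dom: "qt \<in> ext_dom h"
    unfolding qt by (rule arg_min_composite(1)[OF h bdd s zero_less_one F F'])
  have min: "grad g pt \<bullet> qt + (2 * L + \<mu>) / 2 * (norm (qt - pt))\<^sup>2 + real_of_ereal (h qt)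
      \<le> grad g pt \<bullet> u + (2 * L + \<mu>) / 2 * (norm (u - pt))\<^sup>2 + real_of_ereal (h u)" if "u \<in> ext_dom h" for u
    using arg_min_composite(2)[OF h bdd s zero_less_one F F' that] unfolding qt[symmetric]
    by (simp add: inner_diff_right)
  define c where "c = g pt + grad g pt \<bullet> (qt - pt) + real_of_ereal (h qt) + \<mu> / 2 * (norm (pt - qt))\<^sup>2"
  have "obj qt \<le> c + L * (norm (pt - qt))\<^sup>2"
    using upper[of qt pt] by (simp add: c_def norm_minus_commute add_divide_distrib algebra_simps)
  moreover have "c + 2 * L * ((pt - qt) \<bullet> (y - qt)) + \<mu> / 2 * (norm (y - qt))\<^sup>2 \<le> obj y"
    if y: "y \<in> ext_dom h" for y
  proof -
    have "real_of_ereal (h qt) + ((2 * L + \<mu>) *\<^sub>R (pt - qt) - grad g pt) \<bullet> (y - qt) \<le> real_of_ereal (h y)"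
      by (rule proximal_optimality[OF h dom y min])
    moreover have "\<mu> / 2 * (norm (y - pt))\<^sup>2 = \<mu> / 2 * (norm (y - qt))\<^sup>2 - \<mu> * ((pt - qt) \<bullet> (y - qt))
        + \<mu> / 2 * (norm (pt - qt))\<^sup>2"
      unfolding power2_norm_eq_inner by (simp add: inner_simps inner_commute algebra_simps)
    moreover have "grad g pt \<bullet> (y - pt) = grad g pt \<bullet> (y - qt) + grad g pt \<bullet> (qt - pt)"
      by (simp add: inner_simps)
    moreover have "((2 * L + \<mu>) *\<^sub>R (pt - qt) - grad g pt) \<bullet> (y - qt)
        = 2 * L * ((pt - qt) \<bullet> (y - qt)) + \<mu> * ((pt - qt) \<bullet> (y - qt)) - grad g pt \<bullet> (y - qt)"
      by (simp add: inner_diff_left[of "_ *\<^sub>R _"] distrib_right)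
    ultimately show ?thesis using lower[of pt y] unfolding c_def by linarith
  qed
  ultimately show "\<exists>c. obj qt \<le> c + L * (norm (pt - qt))\<^sup>2 \<and>
      (\<forall>y\<in>ext_dom h. c + 2 * L * ((pt - qt) \<bullet> (y - qt)) + \<mu> / 2 * (norm (y - qt))\<^sup>2 \<le> obj y)"
    by blast
qed

text \<open>The minorant is used at \<open>q\<close> with weight \<open>S\<close> and at
  \<open>u\<close> with weight \<open>s\<close>, the upper bound at \<open>qt\<close> with weight
  \<open>S + s\<close>, so the constant \<open>c\<close> cancels. Of the next \<open>q\<close> only
  a value not above that of \<open>qt\<close> enters, so every tie-breaking flag is
  admissible.\<close>

lemma acg_step_potential:
  fixes st and t :: bool
  assumes S: "0 \<le> acg_S st" and tau: "acg_tau st = 1 + \<mu> * acg_S st" and q: "acg_q st \<in> ext_dom h"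
    and u: "u \<in> ext_dom h"
  defines "st' \<equiv> acg_step g h L \<mu> t st"
  shows "acg_q st' \<in> ext_dom h"
    and "acg_S st' * (obj (acg_q st') - obj u) + acg_tau st' / 2 * (norm (acg_p st' - u))\<^sup>2
      \<le> acg_S st * (obj (acg_q st) - obj u) + acg_tau st / 2 * (norm (acg_p st - u))\<^sup>2"
proof -
  define s S \<tau> p q pt qt where
    "s = acg_s L st" and "S = acg_S st" and "\<tau> = acg_tau st" and "p = acg_p st" and "q = acg_q st"
    and "pt = acg_p_tilde L st" and "qt = acg_q_tilde g h L \<mu> st"
  have tau': "0 < \<tau>" using mu S tau by (simp add: \<tau>_def add_pos_nonneg)
  have s: "0 < s" "2 * L * s\<^sup>2 = \<tau> * (S + s)"
    using acg_s_properties[OF L S] tau' by (auto simp: s_def S_def \<tau>_def)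
  have S': "0 \<le> S" "0 < S + s" using S s by (auto simp: S_def)
  have qtd: "qt \<in> ext_dom h" unfolding qt_def by (rule acg_q_tilde_model)
  have st': "acg_S st' = S + s" "acg_tau st' = \<tau> + \<mu> * s"
    by (simp_all add: st'_def acg_step_def Let_def S_def s_def \<tau>_def)
  have p': "acg_p st' = (1 / ((S + s) * \<mu> + 1)) *\<^sub>R (((2 * L + \<mu>) * s) *\<^sub>R qt - (2 * S * s * L / (S + s)) *\<^sub>R q)"
    by (simp add: st'_def acg_step_def Let_def S_def s_def qt_def q_def)
  have dom_real: "ereal (g x) + h x = ereal (obj x)" if "x \<in> ext_dom h" for x
    by (subst proper_ereal_real[OF h that]) simp
  have q': "acg_q st' = (if obj qt < obj q \<or> obj qt = obj q \<and> t then qt else q)"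
    using dom_real[OF qtd] dom_real[OF q]
    by (simp add: st'_def acg_step_def Let_def qt_def q_def)
  show "acg_q st' \<in> ext_dom h" using q' qtd q by (simp add: q_def)
  have q'le: "obj (acg_q st') \<le> obj qt" by (simp add: q')
  have ptS: "(S + s) *\<^sub>R pt = S *\<^sub>R q + s *\<^sub>R p"
    using S' by (simp add: pt_def acg_p_tilde_def Let_def S_def s_def q_def p_def scaleR_add_right)
  then have e: "(S + s) *\<^sub>R (pt - qt) = S *\<^sub>R (q - qt) + s *\<^sub>R (p - qt)"
    by (simp add: algebra_simps)
  have tau'': "\<tau> + \<mu> * s = (S + s) * \<mu> + 1" using tau by (simp add: \<tau>_def S_def algebra_simps)
  \<comment> \<open>The update of \<open>p\<close> is written with \<open>q\<close>, while the
    estimate-sequence inequality needs \<open>p\<close> and \<open>pt\<close>; the equation for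
    \<open>s\<close> turns the coefficient of \<open>p\<close> into \<tau> and allows the
    exchange.\<close>
  have "(2 * L * s) *\<^sub>R pt = (2 * L * s / (S + s)) *\<^sub>R ((S + s) *\<^sub>R pt)" using S' by simp
  also have "\<dots> = (2 * S * s * L / (S + s)) *\<^sub>R q + (2 * L * s\<^sup>2 / (S + s)) *\<^sub>R p"
    unfolding ptS by (simp add: scaleR_add_right power2_eq_square algebra_simps)
  also have "2 * L * s\<^sup>2 / (S + s) = \<tau>" using s S' by simp
  finally have lp: "(2 * L * s) *\<^sub>R pt = (2 * S * s * L / (S + s)) *\<^sub>R q + \<tau> *\<^sub>R p" .
  have "(\<tau> + \<mu> * s) *\<^sub>R acg_p st' = ((2 * L + \<mu>) * s) *\<^sub>R qt - (2 * S * s * L / (S + s)) *\<^sub>R q"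
  proof -
    have "0 < (S + s) * \<mu> + 1" using S' mu by (simp add: add_nonneg_pos)
    then show ?thesis unfolding p' tau'' by simp
  qed
  then have w: "(\<tau> + \<mu> * s) *\<^sub>R (acg_p st' - qt) = \<tau> *\<^sub>R (p - qt) - (2 * L * s) *\<^sub>R (pt - qt)"
    using lp by (simp add: algebra_simps)
  obtain c where c: "obj qt \<le> c + L * (norm (pt - qt))\<^sup>2"
    "\<And>y. y \<in> ext_dom h \<Longrightarrow> c + 2 * L * ((pt - qt) \<bullet> (y - qt)) + \<mu> / 2 * (norm (y - qt))\<^sup>2 \<le> obj y"
    using acg_q_tilde_model(2)[of st] unfolding pt_def[symmetric] qt_def[symmetric] by blast
  have "(\<tau> + \<mu> * s) / 2 * (norm (acg_p st' - u))\<^sup>2 + (S + s) * (L * (norm (pt - qt))\<^sup>2)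
     \<le> S * (2 * L * ((pt - qt) \<bullet> (q - qt)) + \<mu> / 2 * (norm (q - qt))\<^sup>2)
       + s * (2 * L * ((pt - qt) \<bullet> (u - qt)) + \<mu> / 2 * (norm (u - qt))\<^sup>2) + \<tau> / 2 * (norm (p - u))\<^sup>2"
    using estimate_sequence_inequality[OF S'(1) mu tau' s(1) e s(2) w, of "u - qt"]
    by (simp add: norm_minus_commute)
  moreover have "S * (c + 2 * L * ((pt - qt) \<bullet> (q - qt)) + \<mu> / 2 * (norm (q - qt))\<^sup>2) \<le> S * obj q"
    using c(2)[of q] q S' by (intro mult_left_mono) (auto simp: q_def)
  moreover have "s * (c + 2 * L * ((pt - qt) \<bullet> (u - qt)) + \<mu> / 2 * (norm (u - qt))\<^sup>2) \<le> s * obj u"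
    using c(2)[OF u] s by (intro mult_left_mono) auto
  moreover have "(S + s) * obj (acg_q st') \<le> (S + s) * (c + L * (norm (pt - qt))\<^sup>2)"
    using c(1) q'le S' by (intro mult_left_mono) auto
  ultimately have "(S + s) * (obj (acg_q st') - obj u) + (\<tau> + \<mu> * s) / 2 * (norm (acg_p st' - u))\<^sup>2
      \<le> S * (obj q - obj u) + \<tau> / 2 * (norm (p - u))\<^sup>2"
    by (simp add: algebra_simps)
  then show "acg_S st' * (obj (acg_q st') - obj u) + acg_tau st' / 2 * (norm (acg_p st' - u))\<^sup>2
      \<le> acg_S st * (obj (acg_q st) - obj u) + acg_tau st / 2 * (norm (acg_p st - u))\<^sup>2"
    by (simp add: st' S_def \<tau>_def p_def q_def)
qed

lemma acg_scalars:
  "0 \<le> acg_S (acg g h L \<mu> t p0 j)" "acg_tau (acg g h L \<mu> t p0 j) = 1 + \<mu> * acg_S (acg g h L \<mu> t p0 j)"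
proof -
  have "0 \<le> acg_S (acg g h L \<mu> t p0 j) \<and> acg_tau (acg g h L \<mu> t p0 j) = 1 + \<mu> * acg_S (acg g h L \<mu> t p0 j)"
  proof (induction j)
    case (Suc j)
    then have "0 < acg_tau (acg g h L \<mu> t p0 j)" using mu by (simp add: add_pos_nonneg)
    with Suc acg_s_properties(1)[OF L] show ?case
      by (force simp: acg_step_def Let_def algebra_simps intro: add_nonneg_nonneg less_imp_le)
  qed simp
  then show "0 \<le> acg_S (acg g h L \<mu> t p0 j)" "acg_tau (acg g h L \<mu> t p0 j) = 1 + \<mu> * acg_S (acg g h L \<mu> t p0 j)"
    by auto
qed

text \<open>The recursion starts with \<open>S = 0\<close> and \<open>tau = 1\<close>, so the
  initial potential is half a squared distance, however large the objective is at
  \<open>p0\<close>.\<close>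

lemma acg_potential:
  assumes "p0 \<in> ext_dom h" "u \<in> ext_dom h"
  shows "acg_q (acg g h L \<mu> t p0 j) \<in> ext_dom h"
    and "acg_S (acg g h L \<mu> t p0 j) * (obj (acg_q (acg g h L \<mu> t p0 j)) - obj u)
      + acg_tau (acg g h L \<mu> t p0 j) / 2 * (norm (acg_p (acg g h L \<mu> t p0 j) - u))\<^sup>2 \<le> (norm (p0 - u))\<^sup>2 / 2"
proof -
  show dom: "acg_q (acg g h L \<mu> t p0 j) \<in> ext_dom h" for j
    using assms acg_step_potential(1)[OF acg_scalars] by (induction j) auto
  show "acg_S (acg g h L \<mu> t p0 j) * (obj (acg_q (acg g h L \<mu> t p0 j)) - obj u)
      + acg_tau (acg g h L \<mu> t p0 j) / 2 * (norm (acg_p (acg g h L \<mu> t p0 j) - u))\<^sup>2 \<le> (norm (p0 - u))\<^sup>2 / 2"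
  proof (induction j)
    case (Suc j)
    show ?case using acg_step_potential(2)[OF acg_scalars dom assms(2), where t = "t j"] Suc
      unfolding acg.simps by (rule order_trans)
  qed simp
qed

text \<open>The equation for \<open>s\<close> gives
  \<open>\<mu> * S\<^sup>2 \<le> 2 * L * s\<^sup>2\<close>, so each step multiplies \<open>S\<close>
  by at least \<open>1 + sqrt (\<mu> / (2 * L))\<close>. The count starts at index 1, where
  \<open>S = 1 / (2 * L)\<close>, because the initial \<open>S\<close> is 0.\<close>

lemma acg_S_growth:
  "(1 / (2 * L)) * (1 + sqrt (\<mu> / (2 * L))) ^ j \<le> acg_S (acg g h L \<mu> t p0 (Suc j))"
proof (induction j)
  case 0
  then show ?case using L by (simp add: acg_step_def Let_def acg_s_def)
next
  case (Suc j)
  let ?st = "acg g h L \<mu> t p0 (Suc j)"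
  define s S where "s = acg_s L ?st" and "S = acg_S ?st"
  have S: "0 \<le> S" "acg_tau ?st = 1 + \<mu> * S" unfolding S_def by (rule acg_scalars)+
  then have "0 < acg_tau ?st" using mu by (simp add: add_pos_nonneg)
  then have s: "0 < s" "2 * L * s\<^sup>2 = (1 + \<mu> * S) * (S + s)"
    using acg_s_properties[OF L, of ?st] S unfolding s_def S_def by auto
  have "\<mu> * S * S \<le> (1 + \<mu> * S) * (S + s)" using S s mu by (intro mult_mono) auto
  then have "\<mu> * S\<^sup>2 \<le> 2 * L * s\<^sup>2" using s by (simp add: power2_eq_square mult.assoc)
  then have "\<mu> / (2 * L) * S\<^sup>2 \<le> s\<^sup>2" using L by (simp add: field_simps)
  then have "sqrt (\<mu> / (2 * L) * S\<^sup>2) \<le> sqrt (s\<^sup>2)" by (rule real_sqrt_le_mono)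
  then have "sqrt (\<mu> / (2 * L)) * S \<le> s" using S s unfolding real_sqrt_mult by simp
  then have "(1 + sqrt (\<mu> / (2 * L))) * S \<le> S + s" by (simp add: distrib_right)
  moreover have "(1 + sqrt (\<mu> / (2 * L))) * ((1 / (2 * L)) * (1 + sqrt (\<mu> / (2 * L))) ^ j)
      \<le> (1 + sqrt (\<mu> / (2 * L))) * S"
    using Suc mu L unfolding S_def by (intro mult_left_mono) auto
  moreover have "acg_S (acg g h L \<mu> t p0 (Suc (Suc j))) = S + s"
    unfolding acg.simps(2)[of _ _ _ _ _ _ "Suc j"] by (simp add: acg_step_def Let_def s_def S_def del: acg.simps)
  ultimately show ?case by (simp add: mult.left_commute)
qed

text \<open>The two terms of the potential bound \<open>q\<close> and \<open>p\<close> separately: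
  the first by strong convexity at the minimizer, the second since
  \<open>tau = 1 + \<mu> * S\<close>. Their convex combination inherits the bound once square roots
  are taken.\<close>

lemma acg_point_distance:
  assumes p0: "p0 \<in> ext_dom h" and x: "x \<in> ext_dom h" and opt: "- grad g x \<in> subdifferential h x"
  shows "\<mu> * acg_S (acg g h L \<mu> t p0 j) * (norm (acg_p_tilde L (acg g h L \<mu> t p0 j) - x))\<^sup>2 \<le> (norm (p0 - x))\<^sup>2"
proof -
  let ?st = "acg g h L \<mu> t p0 j"
  let ?S = "acg_S ?st" and ?q = "acg_q ?st" and ?p = "acg_p ?st" and ?s = "acg_s L ?st"
  note S = acg_scalars[of t p0 j]
  note q = acg_potential(1)[OF p0 x, of t j]
  have strong: "\<mu> / 2 * (norm (y - x))\<^sup>2 \<le> obj y - obj x" if y: "y \<in> ext_dom h" for y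
    using opt lower[of x y] y by (simp add: subdifferential_iff[OF h x]) fastforce
  have nn: "0 \<le> ?S * (obj ?q - obj x)"
  proof -
    have "0 \<le> \<mu> / 2 * (norm (?q - x))\<^sup>2" using mu by simp
    with strong[OF q] have "0 \<le> obj ?q - obj x" by (rule order_trans[rotated])
    with S(1) show ?thesis by (rule mult_nonneg_nonneg)
  qed
  have pot: "?S * (obj ?q - obj x) + (1 + \<mu> * ?S) / 2 * (norm (?p - x))\<^sup>2 \<le> (norm (p0 - x))\<^sup>2 / 2"
    using acg_potential(2)[OF p0 x, of t j] S(2) by simp
  have c: "0 \<le> \<mu> * ?S" using mu S by simp
  have "?S * (\<mu> / 2 * (norm (?q - x))\<^sup>2) \<le> ?S * (obj ?q - obj x)"
    using strong[OF q] S(1) by (rule mult_left_mono)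
  moreover have "0 \<le> (1 + \<mu> * ?S) / 2 * (norm (?p - x))\<^sup>2" using c by simp
  ultimately have Q: "\<mu> * ?S * (norm (?q - x))\<^sup>2 \<le> (norm (p0 - x))\<^sup>2"
    using pot by (simp add: mult.commute mult.left_commute)
  have "\<mu> * ?S / 2 * (norm (?p - x))\<^sup>2 \<le> (1 + \<mu> * ?S) / 2 * (norm (?p - x))\<^sup>2"
    by (intro mult_right_mono) auto
  then have P: "\<mu> * ?S * (norm (?p - x))\<^sup>2 \<le> (norm (p0 - x))\<^sup>2"
    using pot nn by simp
  have s: "0 < ?s" using acg_s_properties(1)[OF L S(1)] S(2) c by simp
  have sq: "sqrt (\<mu> * ?S) * norm (y - x) \<le> norm (p0 - x)" if "\<mu> * ?S * (norm (y - x))\<^sup>2 \<le> (norm (p0 - x))\<^sup>2" for y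
    using real_sqrt_le_mono[OF that] by (simp add: real_sqrt_mult)
  have S': "0 < ?S + ?s" using S s by simp
  have "acg_p_tilde L ?st - x = (?S / (?S + ?s)) *\<^sub>R (?q - x) + (?s / (?S + ?s)) *\<^sub>R (?p - x)"
  proof -
    have "(?S / (?S + ?s)) *\<^sub>R x + (?s / (?S + ?s)) *\<^sub>R x = x"
      using S' by (simp add: scaleR_add_left[symmetric] add_divide_distrib[symmetric])
    then show ?thesis by (simp add: acg_p_tilde_def Let_def scaleR_diff_right algebra_simps)
  qed
  then have "norm (acg_p_tilde L ?st - x) \<le> ?S / (?S + ?s) * norm (?q - x) + ?s / (?S + ?s) * norm (?p - x)"
    using norm_triangle_ineq[of "(?S / (?S + ?s)) *\<^sub>R (?q - x)" "(?s / (?S + ?s)) *\<^sub>R (?p - x)"] S s by simp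
  then have "sqrt (\<mu> * ?S) * norm (acg_p_tilde L ?st - x)
      \<le> sqrt (\<mu> * ?S) * (?S / (?S + ?s) * norm (?q - x) + ?s / (?S + ?s) * norm (?p - x))"
    using c by (intro mult_left_mono) auto
  also have "\<dots> = ?S / (?S + ?s) * (sqrt (\<mu> * ?S) * norm (?q - x)) + ?s / (?S + ?s) * (sqrt (\<mu> * ?S) * norm (?p - x))"
    by (simp add: algebra_simps)
  also have "\<dots> \<le> ?S / (?S + ?s) * norm (p0 - x) + ?s / (?S + ?s) * norm (p0 - x)"
    using sq[OF Q] sq[OF P] S s by (intro add_mono mult_left_mono) auto
  also have "\<dots> = norm (p0 - x)"
    using S' by (simp add: distrib_right[symmetric] add_divide_distrib[symmetric])
  finally have "(sqrt (\<mu> * ?S) * norm (acg_p_tilde L ?st - x))\<^sup>2 \<le> (norm (p0 - x))\<^sup>2"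
    using c by (intro power_mono) auto
  then show ?thesis using c by (simp add: power_mult_distrib)
qed

end

section \<open>Smooth functions\<close>

lemma grad_eqI: "GDERIV s x :> D \<Longrightarrow> grad s x = D"
  unfolding grad_def
proof (rule the_equality)
  fix D' assume D: "GDERIV s x :> D" and D': "GDERIV s x :> D'"
  have "(\<lambda>h. h \<bullet> D') = (\<lambda>h. h \<bullet> D)"
    using has_derivative_unique[of s] D D' unfolding gderiv_def by blast
  then have "(D' - D) \<bullet> D' = (D' - D) \<bullet> D" by metis
  then have "(D' - D) \<bullet> (D' - D) = 0" by (simp add: inner_diff_right)
  then show "D' = D" by simp
qed

lemma smooth_with_GDERIV: "smooth_with L s \<Longrightarrow> GDERIV s x :> grad s x"
  unfolding smooth_with_def using grad_eqI by metis

lemma GDERIV_line: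
  assumes "GDERIV s (x + e *\<^sub>R d) :> D"
  shows "((\<lambda>e. s (x + e *\<^sub>R d)) has_real_derivative D \<bullet> d) (at e)"
proof -
  have "((\<lambda>e. x + e *\<^sub>R d) has_derivative (\<lambda>r. r *\<^sub>R d)) (at e)"
    by (auto intro!: derivative_eq_intros)
  from has_derivative_compose[OF this assms[unfolded gderiv_def]] show ?thesis
    by (simp add: has_field_derivative_def inner_commute mult_commute_abs)
qed

lemma convex_above_tangent:
  assumes "convex_on UNIV f" and D: "GDERIV f x :> D"
  shows "f x + D \<bullet> (y - x) \<le> f y"
proof -
  have "((\<lambda>e. (f (x + e *\<^sub>R (y - x)) - f x) / e) \<longlongrightarrow> D \<bullet> (y - x)) (at 0)"
    using GDERIV_line[of f x 0 "y - x" D] D by (simp add: DERIV_def)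
  then have "((\<lambda>e. (f (x + e *\<^sub>R (y - x)) - f x) / e) \<longlongrightarrow> D \<bullet> (y - x)) (at_right 0)"
    by (rule filterlim_mono) (auto simp: at_le)
  moreover have "\<forall>\<^sub>F e in at_right 0. (f (x + e *\<^sub>R (y - x)) - f x) / e \<le> f y - f x"
    unfolding eventually_at_right[OF zero_less_one]
  proof (intro exI[of _ 1] conjI allI impI)
    fix e :: real assume e: "0 < e" "e < 1"
    have "f ((1 - e) *\<^sub>R x + e *\<^sub>R y) \<le> (1 - e) * f x + e * f y"
      using convex_onD[OF assms(1)] e by simp
    then have "f (x + e *\<^sub>R (y - x)) - f x \<le> (f y - f x) * e" by (simp add: algebra_simps)
    then show "(f (x + e *\<^sub>R (y - x)) - f x) / e \<le> f y - f x" using e by (simp add: divide_le_eq)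
  qed simp
  ultimately have "D \<bullet> (y - x) \<le> f y - f x" by (intro tendsto_upperbound) auto
  then show ?thesis by simp
qed

text \<open>No integral of the gradient is taken: \<open>\<phi>\<close>, the gap along the segment,
  has nonpositive derivative by the Lipschitz condition, so
  \<open>\<phi> 1 \<le> \<phi> 0\<close>.\<close>

lemma descent_lemma:
  assumes s: "smooth_with L s"
  shows "s y \<le> s x + grad s x \<bullet> (y - x) + L / 2 * (norm (y - x))\<^sup>2"
proof -
  define d where "d = y - x"
  define \<phi> where "\<phi> e = s (x + e *\<^sub>R d) - e * (grad s x \<bullet> d) - L / 2 * e\<^sup>2 * (norm d)\<^sup>2" for e
  have deriv: "(\<phi> has_real_derivative grad s (x + e *\<^sub>R d) \<bullet> d - grad s x \<bullet> d - L * e * (norm d)\<^sup>2) (at e)" for e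
    unfolding \<phi>_def
    by (rule derivative_eq_intros GDERIV_line[OF smooth_with_GDERIV[OF s]] refl | simp)+
  have "grad s (x + e *\<^sub>R d) \<bullet> d - grad s x \<bullet> d - L * e * (norm d)\<^sup>2 \<le> 0" if "0 \<le> e" for e
  proof -
    have "(grad s (x + e *\<^sub>R d) - grad s x) \<bullet> d \<le> norm (grad s (x + e *\<^sub>R d) - grad s x) * norm d"
      by (rule norm_cauchy_schwarz)
    also have "\<dots> \<le> L * norm (e *\<^sub>R d) * norm d"
      using s lipschitz_onD[of L UNIV "grad s" "x + e *\<^sub>R d" x] unfolding smooth_with_def
      by (intro mult_right_mono) (auto simp: dist_norm)
    finally show ?thesis using that by (simp add: inner_diff_left power2_eq_square mult.assoc)
  qed
  then have "\<exists>y. (\<phi> has_real_derivative y) (at e) \<and> y \<le> 0" if "0 \<le> e" for e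
    using deriv[of e] that by blast
  then have "\<phi> 1 \<le> \<phi> 0" by (intro DERIV_nonpos_imp_nonincreasing[of 0 1 \<phi>]) simp_all
  then show ?thesis by (simp add: \<phi>_def d_def)
qed

lemma smooth_with_nonneg: "smooth_with L s \<Longrightarrow> 0 \<le> L"
  unfolding smooth_with_def using lipschitz_on_nonneg by blast


section \<open>The inner solver\<close>

lemma norm_matrix_vector_le: "norm (A *v x) \<le> spectral_norm A * norm x"
  unfolding spectral_norm_def by (intro onorm matrix_vector_mul_bounded_linear)

lemma spectral_norm_nonneg: "0 \<le> spectral_norm A"
  unfolding spectral_norm_def by (intro onorm_pos_le matrix_vector_mul_bounded_linear)

lemma spectral_norm_pos:
  assumes "A \<noteq> 0" shows "0 < spectral_norm A"
proof -
  obtain x where "A *v x \<noteq> 0" using assms matrix_eq[of A 0] by auto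
  then have "\<not> (\<forall>x. A *v x = 0)" by blast
  then show ?thesis
    unfolding spectral_norm_def by (simp only: onorm_pos_lt[OF matrix_vector_mul_bounded_linear]) blast
qed

lemma inner_transpose_matrix_vector: "x \<bullet> (transpose A *v z) = (A *v x) \<bullet> (z :: real^'m)"
  by (metis dot_lmul_matrix inner_commute transpose_matrix_vector)

lemma norm_transpose_matrix_vector_le: "norm (transpose A *v z) \<le> spectral_norm A * norm z"
proof -
  let ?w = "transpose A *v z"
  have "norm ?w * norm ?w = (A *v ?w) \<bullet> z"
    by (simp flip: inner_transpose_matrix_vector power2_norm_eq_inner add: power2_eq_square)
  also have "\<dots> \<le> norm (A *v ?w) * norm z" by (rule norm_cauchy_schwarz)
  also have "\<dots> \<le> spectral_norm A * norm ?w * norm z"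
    by (intro mult_right_mono norm_matrix_vector_le) auto
  finally show ?thesis using spectral_norm_nonneg[of A] by (cases "norm ?w = 0") (auto simp: mult_ac)
qed

text \<open>The parameters stay free apart from signs and ranges; the choices of the theorem come in
  only when iterations are counted. \<open>nontrivial\<close> makes \<open>M\<close> positive, and
  \<open>acg_s\<close> divides by \<open>M\<close>.\<close>

locale ialm_problem = ialm f h A b Lf D x0 \<rho> \<epsilon>0 \<alpha> \<epsilon> \<sigma> t
  for f :: "real^'n \<Rightarrow> real" and h :: "real^'n \<Rightarrow> ereal"
    and A :: "real^'n^'m" and b :: "real^'m"
    and Lf D :: real and x0 :: "real^'n" and \<rho> \<epsilon>0 \<alpha> \<epsilon> \<sigma> :: real
    and t :: "nat \<Rightarrow> nat \<Rightarrow> bool" +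
  assumes f: "convex_on UNIV f" and f_smooth: "smooth_with Lf f"
    and h: "proper_closed_convex h" and bdd: "bounded (ext_dom h)"
    and D: "\<And>x y. x \<in> ext_dom h \<Longrightarrow> y \<in> ext_dom h \<Longrightarrow> norm (x - y) \<le> D" and D_pos: "0 < D"
    and nontrivial: "0 < Lf \<or> A \<noteq> 0" and x0: "x0 \<in> ext_dom h"
    and rho: "0 < \<rho>" and eps0: "0 < \<epsilon>0" and alpha: "0 < \<alpha>" "\<alpha> < 1" and eps: "0 < \<epsilon>" and sigma: "0 < \<sigma>"
begin

lemma eps_pos: "0 < eps k"
  using eps0 alpha eps sigma rho by (simp add: eps_def add_pos_pos)

lemma mu_pos: "0 < mu k"
  using eps_pos D_pos by (simp add: mu_def)

lemma M_pos: "0 < M"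
proof (cases "A = 0")
  case True
  then show ?thesis unfolding M_def using nontrivial rho by (simp add: add_pos_nonneg)
next
  case False
  then show ?thesis using smooth_with_nonneg[OF f_smooth] rho spectral_norm_pos[OF False]
    unfolding M_def by (simp add: add_nonneg_pos)
qed

lemma stepsize_pos: "0 < stepsize k"
  using mu_pos[of k] M_pos by (simp add: stepsize_def)

text \<open>The 1/2 obtained from taking \<open>2 * M\<close> in the step length becomes the 3/2 in
  \<open>acg_stopI\<close> and in \<open>x_next_stationary\<close>.\<close>

lemma stepsize_M: "stepsize k * M \<le> 1 / 2"
proof -
  have "M / (2 * M + mu k) \<le> 1 / 2" using mu_pos[of k] M_pos by (simp add: divide_le_eq)
  moreover have "stepsize k * M = M / (2 * M + mu k)" unfolding stepsize_def by (simp only: divide_inverse mult.commute)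
  ultimately show ?thesis by simp
qed

lemma GDERIV_smooth_part:
  "GDERIV (smooth_part lam) x :> grad f x + transpose A *v (lam + \<rho> *\<^sub>R (A *v x - b))"
proof -
  have A: "((\<lambda>x. A *v x) has_derivative (\<lambda>d. A *v d)) (at x)"
    by (rule bounded_linear.has_derivative[OF matrix_vector_mul_bounded_linear has_derivative_ident])
  have f': "(f has_derivative (\<lambda>d. d \<bullet> grad f x)) (at x)"
    using smooth_with_GDERIV[OF f_smooth] unfolding gderiv_def .
  have "smooth_part lam = (\<lambda>x. f x + lam \<bullet> (A *v x - b) + \<rho> / 2 * ((A *v x - b) \<bullet> (A *v x - b)))"
    by (simp add: smooth_part_def power2_norm_eq_inner fun_eq_iff)
  moreover have "((\<lambda>x. f x + lam \<bullet> (A *v x - b) + \<rho> / 2 * ((A *v x - b) \<bullet> (A *v x - b))) has_derivative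
      (\<lambda>d. d \<bullet> (grad f x + transpose A *v (lam + \<rho> *\<^sub>R (A *v x - b))))) (at x)"
    by (rule derivative_eq_intros f' A refl)+
      (simp only: fun_eq_iff inner_add_right inner_transpose_matrix_vector,
        simp add: inner_commute algebra_simps)
  ultimately show ?thesis unfolding gderiv_def by simp
qed

lemmas grad_smooth_part = grad_eqI[OF GDERIV_smooth_part]

text \<open>The penalty is quadratic and expands exactly, so the only remainder left to estimate is
  that of \<open>f\<close>: nonnegative by convexity, at most quadratic by
  \<open>descent_lemma\<close>.\<close>

lemma smooth_part_expansion:
  "smooth_part lam y = smooth_part lam x + grad (smooth_part lam) x \<bullet> (y - x)
     + (f y - f x - grad f x \<bullet> (y - x)) + \<rho> / 2 * (norm (A *v (y - x)))\<^sup>2"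
proof -
  have A: "A *v y - b = (A *v x - b) + A *v (y - x)" by (simp add: matrix_vector_mult_diff_distrib)
  have "smooth_part lam y = f y + lam \<bullet> ((A *v x - b) + A *v (y - x))
      + \<rho> / 2 * (norm ((A *v x - b) + A *v (y - x)))\<^sup>2"
    unfolding smooth_part_def A ..
  then show ?thesis
    unfolding grad_smooth_part inner_add_left[of _ _ "y - x"] inner_commute[of "transpose A *v _"]
      inner_transpose_matrix_vector smooth_part_def power2_norm_eq_inner
    by (simp add: inner_add_left inner_add_right inner_commute algebra_simps)
qed

lemma smooth_part_bounds:
  "smooth_part lam x + grad (smooth_part lam) x \<bullet> (y - x) \<le> smooth_part lam y"
  "smooth_part lam y \<le> smooth_part lam x + grad (smooth_part lam) x \<bullet> (y - x) + M / 2 * (norm (y - x))\<^sup>2"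
proof -
  show "smooth_part lam x + grad (smooth_part lam) x \<bullet> (y - x) \<le> smooth_part lam y"
  proof -
    have "0 \<le> \<rho> / 2 * (norm (A *v (y - x)))\<^sup>2" using rho by simp
    then show ?thesis
      using convex_above_tangent[OF f smooth_with_GDERIV[OF f_smooth], of x y]
        smooth_part_expansion[of lam y x] by linarith
  qed
  have "(norm (A *v (y - x)))\<^sup>2 \<le> (spectral_norm A * norm (y - x))\<^sup>2"
    by (intro power_mono norm_matrix_vector_le) auto
  then have "\<rho> / 2 * (norm (A *v (y - x)))\<^sup>2 \<le> \<rho> / 2 * (spectral_norm A * norm (y - x))\<^sup>2"
    using rho by (intro mult_left_mono) auto
  then show "smooth_part lam y \<le> smooth_part lam x + grad (smooth_part lam) x \<bullet> (y - x) + M / 2 * (norm (y - x))\<^sup>2"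
    using descent_lemma[OF f_smooth, of y x]
    by (simp add: smooth_part_expansion[of lam y x] M_def power_mult_distrib add_divide_distrib algebra_simps)
qed

lemma grad_smooth_part_lipschitz:
  "norm (grad (smooth_part lam) y - grad (smooth_part lam) x) \<le> M * norm (y - x)"
proof -
  have "(lam + \<rho> *\<^sub>R (A *v y - b)) - (lam + \<rho> *\<^sub>R (A *v x - b)) = \<rho> *\<^sub>R (A *v (y - x))"
    by (simp add: matrix_vector_mult_diff_distrib scaleR_diff_right)
  then have "transpose A *v (lam + \<rho> *\<^sub>R (A *v y - b)) - transpose A *v (lam + \<rho> *\<^sub>R (A *v x - b))
      = \<rho> *\<^sub>R (transpose A *v (A *v (y - x)))"
    by (metis matrix_vector_mult_diff_distrib matrix_vector_mult_scaleR)
  then have "grad (smooth_part lam) y - grad (smooth_part lam) x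
      = (grad f y - grad f x) + \<rho> *\<^sub>R (transpose A *v (A *v (y - x)))"
    unfolding grad_smooth_part by (metis add_diff_add)
  moreover have "norm (grad f y - grad f x) \<le> Lf * norm (y - x)"
    using f_smooth lipschitz_onD[of Lf UNIV "grad f" y x] by (simp add: smooth_with_def dist_norm)
  moreover have "norm (\<rho> *\<^sub>R (transpose A *v (A *v (y - x)))) \<le> \<rho> * (spectral_norm A * (spectral_norm A * norm (y - x)))"
    using rho order_trans[OF norm_transpose_matrix_vector_le
        mult_left_mono[OF norm_matrix_vector_le spectral_norm_nonneg], of A A "y - x"]
    by (simp del: transpose_matrix_vector)
  ultimately have "norm (grad (smooth_part lam) y - grad (smooth_part lam) x)
      \<le> Lf * norm (y - x) + \<rho> * (spectral_norm A * (spectral_norm A * norm (y - x)))"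
    using norm_triangle_mono by metis
  then show ?thesis by (simp add: M_def power2_eq_square algebra_simps)
qed

text \<open>The function that \<open>acg_point\<close> builds inline, named so that the ACG lemmas
  can be instantiated. The coefficient equals \<open>mu k / 2\<close>.\<close>

definition reg_part :: "nat \<Rightarrow> real^'n \<Rightarrow> real^'m \<Rightarrow> real^'n \<Rightarrow> real" where
  "reg_part k x lam u = smooth_part lam u + eps k / (8 * D\<^sup>2) * (norm (u - x))\<^sup>2"

lemma GDERIV_reg_part:
  "GDERIV (reg_part k x lam) u :> grad (smooth_part lam) u + mu k *\<^sub>R (u - x)"
proof -
  have p: "(smooth_part lam has_derivative (\<lambda>d. d \<bullet> grad (smooth_part lam) u)) (at u)"
    using GDERIV_smooth_part[of lam u] unfolding grad_smooth_part gderiv_def .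
  have "reg_part k x lam = (\<lambda>u. smooth_part lam u + mu k / 2 * ((u - x) \<bullet> (u - x)))"
    by (simp add: reg_part_def power2_norm_eq_inner fun_eq_iff mu_def)
  moreover have "((\<lambda>u. smooth_part lam u + mu k / 2 * ((u - x) \<bullet> (u - x))) has_derivative
      (\<lambda>d. d \<bullet> (grad (smooth_part lam) u + mu k *\<^sub>R (u - x)))) (at u)"
    by (rule derivative_eq_intros p refl)+
      (auto simp: fun_eq_iff inner_commute algebra_simps inner_add_right inner_diff_right)
  ultimately show ?thesis unfolding gderiv_def by simp
qed

lemmas grad_reg_part = grad_eqI[OF GDERIV_reg_part]

lemma reg_part_bounds:
  "reg_part k x lam u + grad (reg_part k x lam) u \<bullet> (y - u) + mu k / 2 * (norm (y - u))\<^sup>2 \<le> reg_part k x lam y"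
  "reg_part k x lam y \<le> reg_part k x lam u + grad (reg_part k x lam) u \<bullet> (y - u) + (2 * M + mu k) / 2 * (norm (y - u))\<^sup>2"
proof -
  have "reg_part k x lam y - reg_part k x lam u - grad (reg_part k x lam) u \<bullet> (y - u)
      = smooth_part lam y - smooth_part lam u - grad (smooth_part lam) u \<bullet> (y - u) + mu k / 2 * (norm (y - u))\<^sup>2"
  proof -
    have reg: "reg_part k x lam u = smooth_part lam u + mu k / 2 * ((u - x) \<bullet> (u - x))" for u
      by (simp add: reg_part_def mu_def power2_norm_eq_inner)
    show ?thesis
      unfolding reg grad_reg_part power2_norm_eq_inner
      by (simp add: inner_simps inner_commute algebra_simps add_divide_distrib diff_divide_distrib)
  qed
  moreover have "M / 2 * (norm (y - u))\<^sup>2 + mu k / 2 * (norm (y - u))\<^sup>2 \<le> (2 * M + mu k) / 2 * (norm (y - u))\<^sup>2"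
  proof -
    have "0 \<le> M / 2 * (norm (y - u))\<^sup>2" using M_pos by simp
    then show ?thesis by (simp add: distrib_right add_divide_distrib)
  qed
  ultimately show
    "reg_part k x lam u + grad (reg_part k x lam) u \<bullet> (y - u) + mu k / 2 * (norm (y - u))\<^sup>2 \<le> reg_part k x lam y"
    "reg_part k x lam y \<le> reg_part k x lam u + grad (reg_part k x lam) u \<bullet> (y - u) + (2 * M + mu k) / 2 * (norm (y - u))\<^sup>2"
    using smooth_part_bounds(1)[of lam u y] smooth_part_bounds(2)[of lam y u] by linarith+
qed

lemma continuous_reg_part: "continuous_on UNIV (reg_part k x lam)"
  by (intro continuous_at_imp_continuous_on ballI has_derivative_continuous[OF GDERIV_reg_part[unfolded gderiv_def]])

abbreviation inner_state :: "nat \<Rightarrow> real^'n \<Rightarrow> real^'m \<Rightarrow> nat \<Rightarrow> (real^'n) acg_state" where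
  "inner_state k x lam j \<equiv> acg (reg_part k x lam) h M (mu k) (t k) x j"

lemma acg_point_eq: "acg_point k x lam j = acg_p_tilde M (inner_state k x lam j)"
  by (simp add: acg_point_def reg_part_def[abs_def])

text \<open>The factor 5/2 is 1 + 1 + 1/2: with \<Delta> the distance from the ACG point to the
  minimizer \<open>xs\<close>, reaching \<open>xs\<close> costs \<Delta>, and comparing the two prox
  arguments costs \<Delta> plus half of \<Delta>. The hypothesis makes this part of the residual at
  most \<open>mu k * D\<close>, half of the tolerance.\<close>

lemma acg_stopI:
  assumes x: "x \<in> ext_dom h"
    and S: "(5 / 2 * (2 * (M / mu k) + 1))\<^sup>2 \<le> mu k * acg_S (inner_state k x lam j)"
  shows "acg_stop k x lam j"
proof -
  let ?\<eta> = "stepsize k" and ?pt = "acg_point k x lam j" and ?\<Psi> = "smooth_part lam"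
  obtain xs where xs: "xs \<in> ext_dom h" "- grad (reg_part k x lam) xs \<in> subdifferential h xs"
    by (rule composite_minimizer[where g = "reg_part k x lam" and g' = "grad (reg_part k x lam)"
          and \<kappa> = "2 * M + mu k", OF h bdd continuous_reg_part reg_part_bounds(2)])
  define \<Delta> where "\<Delta> = norm (?pt - xs)"
  have xD: "norm (x - xs) \<le> D" using D x xs by blast
  have "mu k * acg_S (inner_state k x lam j) * \<Delta>\<^sup>2 \<le> (norm (x - xs))\<^sup>2"
    unfolding \<Delta>_def acg_point_eq
    by (rule acg_point_distance[where g = "reg_part k x lam" and L = M and \<mu> = "mu k",
          OF h bdd M_pos less_imp_le[OF mu_pos] reg_part_bounds x xs])
  also have "\<dots> \<le> D\<^sup>2" using xD by (intro power_mono) auto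
  finally have SD: "mu k * acg_S (inner_state k x lam j) * \<Delta>\<^sup>2 \<le> D\<^sup>2" .
  have "(5 / 2 * (2 * (M / mu k) + 1) * \<Delta>)\<^sup>2 \<le> D\<^sup>2"
    unfolding power_mult_distrib[of _ \<Delta>]
    using mult_right_mono[OF S, of "\<Delta>\<^sup>2"] SD by simp
  then have le_D: "5 / 2 * (2 * (M / mu k) + 1) * \<Delta> \<le> D" by (rule power2_le_imp_le) (use D_pos in simp)
  then have close: "5 / 2 * (2 * M + mu k) * \<Delta> \<le> mu k * D"
  proof -
    have "5 / 2 * (2 * M + mu k) * \<Delta> = mu k * (5 / 2 * (2 * (M / mu k) + 1) * \<Delta>)"
      using mu_pos[of k] by (simp add: algebra_simps)
    also have "\<dots> \<le> mu k * D" using le_D mu_pos[of k] by (intro mult_left_mono) auto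
    finally show ?thesis .
  qed
  \<comment> \<open>\<open>xs\<close> is the proximal point of \<open>?w\<close>. The gradient in
    \<open>?w\<close> includes the regularizer, that in \<open>?z\<close> does not; the difference,
    \<open>mu k\<close> times \<open>x - xs\<close>, is at most \<open>mu k * D\<close>, the other
    half.\<close>
  let ?w = "xs - ?\<eta> *\<^sub>R grad (reg_part k x lam) xs" and ?z = "?pt - ?\<eta> *\<^sub>R grad ?\<Psi> ?pt"
  have "norm (prox ?\<eta> h ?z - xs) \<le> norm (?z - ?w)"
    using stepsize_pos[of k] xs by (intro prox_nonexpansive[OF h bdd]) auto
  also have "?z - ?w = ((?pt - xs) - ?\<eta> *\<^sub>R (grad ?\<Psi> ?pt - grad ?\<Psi> xs)) - (?\<eta> * mu k) *\<^sub>R (x - xs)"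
    unfolding grad_reg_part by (simp add: algebra_simps)
  also have "norm \<dots> \<le> (\<Delta> + ?\<eta> * (M * \<Delta>)) + ?\<eta> * mu k * D"
  proof (rule norm_triangle_ineq4[THEN order_trans, OF add_mono])
    have "norm (grad ?\<Psi> ?pt - grad ?\<Psi> xs) \<le> M * \<Delta>" unfolding \<Delta>_def by (rule grad_smooth_part_lipschitz)
    then have "norm (?\<eta> *\<^sub>R (grad ?\<Psi> ?pt - grad ?\<Psi> xs)) \<le> ?\<eta> * (M * \<Delta>)"
      using stepsize_pos[of k] by simp
    then show "norm ((?pt - xs) - ?\<eta> *\<^sub>R (grad ?\<Psi> ?pt - grad ?\<Psi> xs)) \<le> \<Delta> + ?\<eta> * (M * \<Delta>)"
      unfolding \<Delta>_def by (rule order_trans[OF norm_triangle_ineq4 add_mono[OF order_refl]])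
    show "norm ((?\<eta> * mu k) *\<^sub>R (x - xs)) \<le> ?\<eta> * mu k * D"
    proof -
      have "0 \<le> ?\<eta> * mu k" using stepsize_pos[of k] mu_pos[of k] by simp
      then show ?thesis using mult_left_mono[OF xD] by simp
    qed
  qed
  also have "?\<eta> * (M * \<Delta>) \<le> 1 / 2 * \<Delta>"
    using mult_right_mono[OF stepsize_M[of k], of \<Delta>] by (simp add: \<Delta>_def mult.assoc)
  finally have near: "norm (prox ?\<eta> h ?z - xs) \<le> 3 / 2 * \<Delta> + ?\<eta> * mu k * D" by simp
  have "norm (?pt - prox ?\<eta> h ?z) \<le> \<Delta> + norm (prox ?\<eta> h ?z - xs)"
    unfolding \<Delta>_def using norm_triangle_ineq4[of "?pt - xs" "prox ?\<eta> h ?z - xs"] by simp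
  then have "norm (?pt - prox ?\<eta> h ?z) \<le> 5 / 2 * \<Delta> + ?\<eta> * mu k * D" using near by simp
  then have "(1 / ?\<eta>) * norm (?pt - prox ?\<eta> h ?z) \<le> (1 / ?\<eta>) * (5 / 2 * \<Delta> + ?\<eta> * mu k * D)"
    using stepsize_pos[of k] by (intro mult_left_mono) auto
  also have "\<dots> = 5 / 2 * (2 * M + mu k) * \<Delta> + mu k * D"
  proof -
    have "(1 / e) * (5 / 2 * \<Delta> + e * m * D) = 5 / 2 * (1 / e) * \<Delta> + m * D" if "0 < e" for e m :: real
      using that by (simp add: field_simps)
    note scale = this[OF stepsize_pos[of k], of "mu k"]
    have inv: "1 / ?\<eta> = 2 * M + mu k" by (simp add: stepsize_def divide_inverse)
    show ?thesis using scale unfolding inv .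
  qed
  also have "\<dots> \<le> 2 * (mu k * D)" using close by linarith
  also have "\<dots> = eps k / (2 * D)" using D_pos by (simp add: mu_def power2_eq_square)
  finally show ?thesis
    unfolding acg_stop_def G_def grad_map_def using stepsize_pos[of k] by simp
qed

text \<open>With \<kappa> = \<open>M / mu k\<close>, stopping asks for \<open>mu k\<close> times
  \<open>S\<close> to reach 25/4 (1 + 2 \<kappa>)^2, while the guaranteed growth carries the
  prefactor 1 / (2 \<kappa>). Bounding 2 \<kappa> by 1 + 2 \<kappa> produces the cube, hence the
  coefficient 3 of the logarithm.\<close>

lemma acg_call_bound:
  assumes x: "x \<in> ext_dom h"
  shows "\<exists>j. acg_stop k x lam j"
    and "real (acg_last k x lam) + 1
      \<le> 3 + (1 + sqrt (2 * (M / mu k))) * (ln (25 / 4) + 3 * ln (1 + 2 * (M / mu k)))"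
proof -
  define \<kappa> where "\<kappa> = M / mu k"
  define c where "c = sqrt (2 * \<kappa>)"
  define B where "B = ln (25 / 4) + 3 * ln (1 + 2 * \<kappa>)"
  define j where "j = nat \<lceil>(1 + c) * B\<rceil>"
  have \<kappa>: "0 < \<kappa>" unfolding \<kappa>_def using M_pos mu_pos by simp
  have c: "0 < c" "c\<^sup>2 = 2 * \<kappa>" using \<kappa> by (auto simp: c_def)
  have B: "exp B = 25 / 4 * (1 + 2 * \<kappa>) ^ 3" "0 \<le> B"
    using \<kappa> by (auto simp: B_def exp_add exp_of_nat_mult[of 3, simplified])
  have j: "(1 + c) * B \<le> real j" "real j \<le> (1 + c) * B + 1"
    using B c by (auto simp: j_def intro: order_trans[OF _ ceiling_correct[THEN conjunct2]])
  have "1 / (1 + c) \<le> ln (1 + 1 / c)"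
  proof -
    have "ln (c / (1 + c)) \<le> c / (1 + c) - 1" using c by (intro ln_le_minus_one) auto
    also have "c / (1 + c) - 1 = - (1 / (1 + c))" using c by (simp add: field_simps)
    also have "ln (c / (1 + c)) = - ln (1 + 1 / c)"
      using c by (subst ln_inverse[symmetric]) (auto simp: field_simps)
    finally show ?thesis by simp
  qed
  then have "real j * (1 / (1 + c)) \<le> real j * ln (1 + 1 / c)" by (intro mult_left_mono) auto
  moreover have "B \<le> real j * (1 / (1 + c))" using j(1) c by (simp add: field_simps)
  ultimately have "B \<le> real j * ln (1 + 1 / c)" by linarith
  then have "exp B \<le> exp (real j * ln (1 + 1 / c))" by simp
  also have "\<dots> = (1 + 1 / c) ^ j" using c by (simp add: exp_of_nat_mult add_pos_pos)
  finally have pow: "25 / 4 * (1 + 2 * \<kappa>) ^ 3 \<le> (1 + 1 / c) ^ j" using B by simp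
  have rt: "sqrt (mu k / (2 * M)) = 1 / c"
    using M_pos mu_pos[of k] by (simp add: c_def \<kappa>_def real_sqrt_divide real_sqrt_mult)
  have "(5 / 2 * (2 * \<kappa> + 1))\<^sup>2 = 25 / 4 * (1 + 2 * \<kappa>)\<^sup>2" by (simp add: power2_eq_square algebra_simps)
  also have "\<dots> \<le> 1 / (2 * \<kappa>) * (25 / 4 * (1 + 2 * \<kappa>) ^ 3)"
    using \<kappa> by (simp add: field_simps power3_eq_cube power2_eq_square)
  also have "\<dots> \<le> 1 / (2 * \<kappa>) * (1 + 1 / c) ^ j" using pow \<kappa> by (intro mult_left_mono) auto
  also have "\<dots> = mu k * (1 / (2 * M) * (1 + sqrt (mu k / (2 * M))) ^ j)"
    unfolding rt by (simp add: \<kappa>_def)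
  also have "\<dots> \<le> mu k * acg_S (inner_state k x lam (Suc j))"
    using mu_pos[of k]
    by (intro mult_left_mono acg_S_growth[where g = "reg_part k x lam" and L = M and \<mu> = "mu k",
          OF h bdd M_pos less_imp_le[OF mu_pos] reg_part_bounds]) auto
  finally have stop: "acg_stop k x lam (Suc j)"
    unfolding \<kappa>_def by (intro acg_stopI x)
  then show "\<exists>j. acg_stop k x lam j" by blast
  \<comment> \<open>The summand 3: one for the ceiling in \<open>j\<close>, one for the index
    \<open>Suc j\<close> of the growth bound, one because iteration 0 counts.\<close>
  have "acg_last k x lam \<le> Suc j" unfolding acg_last_def using stop by (rule Least_le)
  then show "real (acg_last k x lam) + 1
      \<le> 3 + (1 + sqrt (2 * (M / mu k))) * (ln (25 / 4) + 3 * ln (1 + 2 * (M / mu k)))"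
    using j(2) unfolding c_def B_def \<kappa>_def by linarith
qed

section \<open>What a finished call hands to the outer iteration\<close>

lemma x_tilde_stop:
  assumes "x \<in> ext_dom h"
  shows "norm (G k lam (x_tilde k x lam)) \<le> eps k / (2 * D)"
  using LeastI_ex[OF acg_call_bound(1)[OF assms, of k lam]]
  unfolding x_tilde_def acg_last_def acg_stop_def by simp

lemma x_next_eq: "x_next k x lam = prox (stepsize k) h
    (x_tilde k x lam - stepsize k *\<^sub>R grad (smooth_part lam) (x_tilde k x lam))"
  using stepsize_pos[of k] by (simp add: x_next_def G_def grad_map_def)

lemma x_next_in_dom: "x_next k x lam \<in> ext_dom h"
  unfolding x_next_eq by (rule prox_mem_subdifferential(1)[OF h bdd stepsize_pos])

text \<open>The gradient of the augmented term at \<open>lam\<close> is that of the plain Lagrangian at \<open>lam_next\<close>.\<close>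
lemma x_next_stationary:
  "\<exists>g\<in>subdifferential h (x_next k x lam).
     norm (g + grad f (x_next k x lam) + transpose A *v lam_next k x lam)
       \<le> 3 / 2 * norm (G k lam (x_tilde k x lam))"
proof -
  let ?\<eta> = "stepsize k" and ?xt = "x_tilde k x lam" and ?xn = "x_next k x lam"
  let ?\<Psi> = "smooth_part lam" and ?G = "G k lam (x_tilde k x lam)"
  have diff: "?xt - ?xn = ?\<eta> *\<^sub>R ?G" by (simp add: x_next_def)
  have "(?xt - ?\<eta> *\<^sub>R grad ?\<Psi> ?xt) - ?xn = (?xt - ?xn) - ?\<eta> *\<^sub>R grad ?\<Psi> ?xt" by simp
  also have "\<dots> = ?\<eta> *\<^sub>R (?G - grad ?\<Psi> ?xt)" unfolding diff by (simp add: scaleR_diff_right)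
  finally have "(1 / ?\<eta>) *\<^sub>R ((?xt - ?\<eta> *\<^sub>R grad ?\<Psi> ?xt) - ?xn) = ?G - grad ?\<Psi> ?xt"
    using stepsize_pos[of k] by simp
  then have sub: "?G - grad ?\<Psi> ?xt \<in> subdifferential h ?xn"
    using prox_mem_subdifferential(2)[OF h bdd stepsize_pos, of k "?xt - ?\<eta> *\<^sub>R grad ?\<Psi> ?xt"]
    unfolding x_next_eq[symmetric] by simp
  have "norm (grad ?\<Psi> ?xn - grad ?\<Psi> ?xt) \<le> M * norm (?xn - ?xt)"
    by (rule grad_smooth_part_lipschitz)
  also have "\<dots> = (?\<eta> * M) * norm ?G"
    using stepsize_pos[of k] by (simp add: norm_minus_commute[of ?xn] diff)
  also have "\<dots> \<le> 1 / 2 * norm ?G" by (intro mult_right_mono stepsize_M) auto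
  finally have "norm (?G + (grad ?\<Psi> ?xn - grad ?\<Psi> ?xt)) \<le> 3 / 2 * norm ?G"
    using norm_triangle_ineq[of ?G "grad ?\<Psi> ?xn - grad ?\<Psi> ?xt"] by simp
  moreover have "?G - grad ?\<Psi> ?xt + grad f ?xn + transpose A *v lam_next k x lam
      = ?G + (grad ?\<Psi> ?xn - grad ?\<Psi> ?xt)"
    by (simp add: grad_smooth_part[of lam ?xn] lam_next_def)
  ultimately show ?thesis using sub by metis
qed

lemma iterate_in_dom: "fst (iterate k) \<in> ext_dom h"
  by (cases k) (auto simp: x0 x_next_in_dom)

end

section \<open>Lagrangian duality\<close>

lemma lagrangian_dom:
  assumes "proper_closed_convex h" "x \<in> ext_dom h"
  shows "lagrangian f h A b x lam = ereal (f x + real_of_ereal (h x) + lam \<bullet> (A *v x - b))"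
  unfolding lagrangian_def by (subst proper_ereal_real[OF assms]) simp

lemma lagrangian_notin_dom: "x \<notin> ext_dom h \<Longrightarrow> lagrangian f h A b x lam = \<infinity>"
  by (simp add: lagrangian_def notin_ext_dom)

lemma dual_fun_le:
  assumes "proper_closed_convex h" "x \<in> ext_dom h"
  shows "dual_fun f h A b lam \<le> ereal (f x + real_of_ereal (h x) + lam \<bullet> (A *v x - b))"
  unfolding dual_fun_def using INF_lower[of x UNIV "\<lambda>x. lagrangian f h A b x lam"] lagrangian_dom[OF assms]
  by (metis UNIV_I)

lemma dual_fun_ge:
  assumes h: "proper_closed_convex h"
    and c: "\<And>x. x \<in> ext_dom h \<Longrightarrow> c \<le> f x + real_of_ereal (h x) + lam \<bullet> (A *v x - b)"
  shows "ereal c \<le> dual_fun f h A b lam"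
  unfolding dual_fun_def
proof (rule INF_greatest)
  fix x show "ereal c \<le> lagrangian f h A b x lam"
    using c[of x] lagrangian_dom[OF h, of x f A b lam] lagrangian_notin_dom[of x h f A b lam]
    by (cases "x \<in> ext_dom h") auto
qed

text \<open>A hyperplane supporting the epigraph of the perturbation function at \<open>(0, \<phi>\<^sub>*)\<close>. Proper
  separation together with the relative interior point excludes a vertical one.\<close>
lemma dual_maximizers_nonempty:
  fixes f :: "real^'n \<Rightarrow> real" and A :: "real^'n^'m"
  assumes f: "convex_on UNIV f" and h: "proper_closed_convex h" and bdd: "bounded (ext_dom h)"
    and slater: "rel_interior (ext_dom h) \<inter> {x. A *v x = b} \<noteq> {}"
  shows "dual_maximizers f h A b \<noteq> {}"
proof -
  let ?C = "ext_dom h"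
  let ?\<phi> = "\<lambda>x. f x + real_of_ereal (h x)"
  obtain xb where xb: "xb \<in> rel_interior ?C" "A *v xb = b" using slater by blast
  have xbC: "xb \<in> ?C" using xb rel_interior_subset by blast
  have cont: "continuous_on UNIV f" using f by (simp add: convex_on_continuous)
  have closed: "closed {x. A *v x = b}"
    by (intro closed_Collect_eq continuous_intros matrix_vector_mult_linear_continuous_on)
  have ne: "?C \<inter> {x. A *v x = b} \<noteq> {}" using xb(2) xbC by blast
  obtain xs where xs: "xs \<in> ?C \<inter> {x. A *v x = b}" "\<And>y. y \<in> ?C \<inter> {x. A *v x = b} \<Longrightarrow> ?\<phi> xs \<le> ?\<phi> y"
    by (rule composite_attains_inf[OF h bdd cont closed ne]) (rule that)
  then have xs: "xs \<in> ?C" "A *v xs = b" "\<And>y. y \<in> ?C \<Longrightarrow> A *v y = b \<Longrightarrow> ?\<phi> xs \<le> ?\<phi> y" by simp_all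
  \<comment> \<open>\<open>V\<close> is the epigraph of the objective with each point replaced by
    its constraint residual; \<open>(0, ?\<phi> xs)\<close> is its lowest point over the residual
    0.\<close>
  define V where "V = {(A *v x - b, r) |x r. x \<in> ?C \<and> ?\<phi> x \<le> r}"
  have VI: "(A *v x - b, r) \<in> V" if "x \<in> ?C" "?\<phi> x \<le> r" for x r using that by (auto simp: V_def)
  have "convex_on ?C ?\<phi>"
    by (intro convex_on_add convex_on_ext_dom[OF h] convex_on_subset[OF f] convex_ext_dom[OF h]) auto
  have "convex V"
    unfolding convex_def
  proof (intro ballI allI impI)
    fix p q and u v :: real
    assume "p \<in> V" "q \<in> V" and uv: "0 \<le> u" "0 \<le> v" "u + v = 1"
    then obtain x r y s where p: "p = (A *v x - b, r)" "x \<in> ?C" "?\<phi> x \<le> r"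
      and q: "q = (A *v y - b, s)" "y \<in> ?C" "?\<phi> y \<le> s" by (auto simp: V_def)
    have "u *\<^sub>R x + v *\<^sub>R y \<in> ?C" using convex_ext_dom[OF h] p q uv unfolding convex_def by blast
    moreover have "?\<phi> (u *\<^sub>R x + v *\<^sub>R y) \<le> u * ?\<phi> x + v * ?\<phi> y"
      using \<open>convex_on ?C ?\<phi>\<close> p q uv unfolding convex_on_def by blast
    moreover have "u * ?\<phi> x + v * ?\<phi> y \<le> u * r + v * s"
      using p q uv by (intro add_mono mult_left_mono) auto
    moreover have "u *\<^sub>R (A *v x - b) + v *\<^sub>R (A *v y - b) = A *v (u *\<^sub>R x + v *\<^sub>R y) - (u + v) *\<^sub>R b"
      by (simp add: matrix_vector_right_distrib matrix_vector_mult_scaleR algebra_simps)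
    ultimately show "u *\<^sub>R p + v *\<^sub>R q \<in> V" using p(1) q(1) uv VI by simp
  qed
  have up: "(0, r) \<in> V" if "?\<phi> xs \<le> r" for r using VI[of xs r] xs that by simp
  \<comment> \<open>Otherwise the segment from the point one unit higher could be prolonged beyond
    \<open>(0, ?\<phi> xs)\<close>, giving a feasible point below the optimum.\<close>
  have "(0, ?\<phi> xs) \<notin> rel_interior V"
  proof
    assume "(0, ?\<phi> xs) \<in> rel_interior V"
    then obtain e where e: "1 < e" "(1 - e) *\<^sub>R (0, ?\<phi> xs + 1) + e *\<^sub>R (0, ?\<phi> xs) \<in> V"
      using convex_rel_interior_iff[OF \<open>convex V\<close>] up[of "?\<phi> xs + 1"] by fastforce
    then have "(0, ?\<phi> xs + (1 - e)) \<in> V" by (simp add: algebra_simps)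
    then obtain x where "x \<in> ?C" "A *v x = b" "?\<phi> x \<le> ?\<phi> xs + (1 - e)" by (auto simp: V_def)
    then show False using xs(3)[of x] e by simp
  qed
  then obtain a where a: "\<And>y. y \<in> V \<Longrightarrow> a \<bullet> (0, ?\<phi> xs) \<le> a \<bullet> y"
    "\<And>y. y \<in> rel_interior V \<Longrightarrow> a \<bullet> (0, ?\<phi> xs) < a \<bullet> y"
    by (rule supporting_hyperplane_rel_boundary[OF \<open>convex V\<close> up[OF order_refl]]) (rule that)
  obtain l c where lc: "a = (l, c)" by fastforce
  have sup: "c * ?\<phi> xs \<le> l \<bullet> (A *v x - b) + c * r" if "x \<in> ?C" "?\<phi> x \<le> r" for x r
    using a(1)[OF VI[OF that]] lc by simp
  have "0 \<le> c" using sup[of xs "?\<phi> xs + 1"] xs by (simp add: distrib_left)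
  moreover have "c \<noteq> 0"
  proof
    assume c: "c = 0"
    have nonneg: "0 \<le> l \<bullet> (A *v x - b)" if "x \<in> ?C" for x using sup[OF that order_refl] c by simp
    \<comment> \<open>The segment from \<open>x\<close> can be prolonged beyond \<open>xb\<close>,
      where the residual is zero; there the residual has reversed direction, so the nonnegative
      functional vanishes. Then \<open>a\<close> is zero on all of \<open>V\<close>, against
      strictness on its relative interior.\<close>
    have zero: "l \<bullet> (A *v x - b) = 0" if x: "x \<in> ?C" for x
    proof -
      obtain e where e: "1 < e" "(1 - e) *\<^sub>R x + e *\<^sub>R xb \<in> ?C"
        using xb(1) x convex_rel_interior_iff[OF convex_ext_dom[OF h], of xb] by blast
      have "A *v ((1 - e) *\<^sub>R x + e *\<^sub>R xb) - b = (1 - e) *\<^sub>R (A *v x - b)"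
        using xb(2) by (simp add: matrix_vector_right_distrib matrix_vector_mult_scaleR algebra_simps)
      then have "0 \<le> (1 - e) * (l \<bullet> (A *v x - b))" using nonneg[OF e(2)] by simp
      then have "l \<bullet> (A *v x - b) \<le> 0" using e(1) by (simp add: zero_le_mult_iff)
      then show ?thesis using nonneg[OF x] by simp
    qed
    obtain y where y: "y \<in> rel_interior V"
      using rel_interior_eq_empty[OF \<open>convex V\<close>] up[OF order_refl] by blast
    then have "y \<in> V" using rel_interior_subset by blast
    then have "a \<bullet> y = 0" using zero c by (auto simp: V_def lc)
    then show False using a(2)[OF y] c by (simp add: lc)
  qed
  ultimately have c: "0 < c" by simp
  have ge: "?\<phi> xs \<le> ?\<phi> x + ((1 / c) *\<^sub>R l) \<bullet> (A *v x - b)" if x: "x \<in> ?C" for x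
  proof -
    have "c * ?\<phi> xs \<le> c * (?\<phi> x + ((1 / c) *\<^sub>R l) \<bullet> (A *v x - b))"
      using sup[OF x order_refl] c by (simp add: distrib_left)
    then show ?thesis using c by (simp only: mult_le_cancel_left_pos)
  qed
  \<comment> \<open>Weak duality at \<open>xs\<close> bounds every dual value by the optimum, which
    the normalized slope of the hyperplane attains.\<close>
  have "dual_fun f h A b \<nu> \<le> dual_fun f h A b ((1 / c) *\<^sub>R l)" for \<nu>
  proof -
    have "dual_fun f h A b \<nu> \<le> ereal (?\<phi> xs)" using dual_fun_le[OF h xs(1), of f A b \<nu>] xs(2) by simp
    also have "\<dots> \<le> dual_fun f h A b ((1 / c) *\<^sub>R l)" by (intro dual_fun_ge[OF h] ge)
    finally show ?thesis .
  qed
  then show ?thesis unfolding dual_maximizers_def by blast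
qed

text \<open>\<open>dual_radius\<close> is an infimum, so an estimate valid for each maximizer passes
  to it without a nearest maximizer being produced. Nonemptiness matters because \<open>Inf\<close>
  of the empty set is unspecified.\<close>

lemma le_dual_radius_sq:
  assumes "dual_maximizers f h A b \<noteq> {}"
    and le: "\<And>lam. lam \<in> dual_maximizers f h A b \<Longrightarrow> c \<le> (norm (lam - lam0))\<^sup>2"
  shows "c \<le> (dual_radius f h A b lam0)\<^sup>2"
proof (cases "c \<le> 0")
  case True
  then show ?thesis by (rule order_trans) simp
next
  case False
  have "sqrt c \<le> dual_radius f h A b lam0"
    unfolding dual_radius_def
    using assms(1) real_sqrt_le_mono[OF le] by (intro cInf_greatest) auto
  then have "(sqrt c)\<^sup>2 \<le> (dual_radius f h A b lam0)\<^sup>2" using False by (intro power_mono) auto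
  then show ?thesis using False by simp
qed


section \<open>The outer iteration\<close>

context ialm_problem
begin

text \<open>The multiplier update is an inexact proximal step on the dual.\<close>
lemma lam_next_fejer:
  assumes x: "x \<in> ext_dom h" and ls: "ls \<in> dual_maximizers f h A b"
  shows "(norm (lam_next k x lam - lam))\<^sup>2 + (norm (lam_next k x lam - ls))\<^sup>2
    \<le> (norm (lam - ls))\<^sup>2 + 3 / 2 * (\<rho> * eps k)"
proof -
  let ?x = "x_next k x lam" and ?l = "lam_next k x lam"
  obtain g where g: "g \<in> subdifferential h ?x"
    "norm (g + grad f ?x + transpose A *v ?l) \<le> 3 / 2 * norm (G k lam (x_tilde k x lam))"
    using x_next_stationary by blast
  define v where "v = g + grad f ?x + transpose A *v ?l"
  have vD: "norm v * D \<le> 3 / 4 * eps k"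
  proof -
    have "norm v \<le> 3 / 2 * (eps k / (2 * D))"
      unfolding v_def using g(2) x_tilde_stop[OF x, of k lam] by linarith
    then have "norm v * D \<le> 3 / 2 * (eps k / (2 * D)) * D" using D_pos by (intro mult_right_mono) auto
    then show ?thesis using D_pos by simp
  qed
  note xd = x_next_in_dom[of k x lam]
  \<comment> \<open>Approximate stationarity becomes approximate minimality: convexity of
    \<open>f\<close> and \<open>h\<close> leaves the error \<open>v \<bullet> (u - ?x)\<close>,
    which the diameter bounds below by minus \<open>norm v * D\<close>.\<close>
  have "ereal (f ?x + real_of_ereal (h ?x) + ?l \<bullet> (A *v ?x - b) - 3 / 4 * eps k) \<le> dual_fun f h A b ?l"
  proof (rule dual_fun_ge[OF h])
    fix u assume u: "u \<in> ext_dom h"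
    have "real_of_ereal (h ?x) + g \<bullet> (u - ?x) \<le> real_of_ereal (h u)"
      using g(1) u by (simp add: subdifferential_iff[OF h xd])
    moreover have "f ?x + grad f ?x \<bullet> (u - ?x) \<le> f u"
      by (rule convex_above_tangent[OF f smooth_with_GDERIV[OF f_smooth]])
    moreover have "(transpose A *v ?l) \<bullet> (u - ?x) = ?l \<bullet> (A *v u - b) - ?l \<bullet> (A *v ?x - b)"
    proof -
      have "(transpose A *v ?l) \<bullet> (u - ?x) = (A *v (u - ?x)) \<bullet> ?l"
        by (subst inner_commute) (rule inner_transpose_matrix_vector)
      then show ?thesis by (simp add: matrix_vector_mult_diff_distrib inner_diff_left inner_diff_right inner_commute)
    qed
    moreover have "- (norm v * D) \<le> v \<bullet> (u - ?x)"
    proof -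
      have "\<bar>v \<bullet> (u - ?x)\<bar> \<le> norm v * norm (u - ?x)" by (rule Cauchy_Schwarz_ineq2)
      also have "\<dots> \<le> norm v * D" using D[OF u xd] by (intro mult_left_mono) auto
      finally show ?thesis by linarith
    qed
    moreover have "v \<bullet> (u - ?x) = g \<bullet> (u - ?x) + grad f ?x \<bullet> (u - ?x) + (transpose A *v ?l) \<bullet> (u - ?x)"
      unfolding v_def by (simp only: inner_add_left)
    ultimately show "f ?x + real_of_ereal (h ?x) + ?l \<bullet> (A *v ?x - b) - 3 / 4 * eps k
        \<le> f u + real_of_ereal (h u) + ?l \<bullet> (A *v u - b)"
      using vD by linarith
  qed
  also have "\<dots> \<le> dual_fun f h A b ls" using ls by (simp add: dual_maximizers_def)
  also have "\<dots> \<le> ereal (f ?x + real_of_ereal (h ?x) + ls \<bullet> (A *v ?x - b))"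
    by (rule dual_fun_le[OF h xd])
  finally have "(?l - ls) \<bullet> (A *v ?x - b) \<le> 3 / 4 * eps k" by (simp add: inner_diff_left)
  then have "\<rho> * ((?l - ls) \<bullet> (A *v ?x - b)) \<le> \<rho> * (3 / 4 * eps k)"
    using rho by (intro mult_left_mono) auto
  moreover have "?l - lam = \<rho> *\<^sub>R (A *v ?x - b)" by (simp add: lam_next_def)
  then have "\<rho> * ((?l - ls) \<bullet> (A *v ?x - b)) = (?l - ls) \<bullet> (?l - lam)" by simp
  moreover have "(norm (?l - lam))\<^sup>2 + (norm (?l - ls))\<^sup>2 - (norm (lam - ls))\<^sup>2 = 2 * ((?l - ls) \<bullet> (?l - lam))"
    unfolding power2_norm_eq_inner by (simp add: inner_simps inner_commute)
  ultimately show ?thesis by linarith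
qed

text \<open>Telescoping starts at the multiplier 0, whose squared distance to \<open>ls\<close> is
  \<open>(norm ls)\<^sup>2\<close>.\<close>

lemma sum_multiplier_steps_le:
  assumes ls: "ls \<in> dual_maximizers f h A b"
  shows "(\<Sum>k<K. (norm (snd (iterate (Suc k)) - snd (iterate k)))\<^sup>2) + (norm (snd (iterate K) - ls))\<^sup>2
    \<le> (norm ls)\<^sup>2 + 3 / 2 * (\<Sum>k<K. \<rho> * eps k)"
proof (induction K)
  case (Suc K)
  then show ?case
    using lam_next_fejer[OF iterate_in_dom ls, of K K "snd (iterate K)"] by (simp add: distrib_left)
qed simp

lemma returns_at_first_outer_stop:
  assumes K: "outer_stop K (fst (iterate K)) (snd (iterate K))"
    and first: "\<And>k. k < K \<Longrightarrow> \<not> outer_stop k (fst (iterate k)) (snd (iterate k))"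
  shows "returns (\<Sum>k\<le>K. (acg_last k (fst (iterate k)) (snd (iterate k)) + 1))
      (fst (iterate (Suc K))) (snd (iterate (Suc K)))"
    and "eps_primal_dual f h A b \<epsilon> (fst (iterate (Suc K))) (snd (iterate (Suc K)))"
proof -
  show "returns (\<Sum>k\<le>K. (acg_last k (fst (iterate k)) (snd (iterate k)) + 1))
      (fst (iterate (Suc K))) (snd (iterate (Suc K)))"
    unfolding returns_def using K first acg_call_bound(1)[OF iterate_in_dom]
    by (intro exI[of _ K]) (simp del: iterate.simps)
  \<comment> \<open>The outer test admits only \<open>\<epsilon> / 2\<close>, so the factor 3/2 of
    \<open>x_next_stationary\<close> still leaves at most \<open>3 / 4 * \<epsilon>\<close>.\<close>
  have "3 / 2 * norm (G K (snd (iterate K)) (x_tilde K (fst (iterate K)) (snd (iterate K)))) \<le> \<epsilon>"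
    using K eps unfolding outer_stop_def by linarith
  then show "eps_primal_dual f h A b \<epsilon> (fst (iterate (Suc K))) (snd (iterate (Suc K)))"
    using x_next_stationary[of K "fst (iterate K)" "snd (iterate K)"] K
    unfolding eps_primal_dual_def outer_stop_def by (force simp del: transpose_matrix_vector)
qed

end

text \<open>With the parameters of the theorem an outer iteration that does not stop moves the multiplier
  by more than \<open>\<rho> \<epsilon> = 1\<close>.\<close>
lemma (in ialm_problem) outer_iterations_le:
  assumes rho_eps: "\<rho> * \<epsilon> = 1" and "\<epsilon>0 = \<epsilon>" "\<sigma> = 1 / 2" "1 \<le> D"
    and ls: "ls \<in> dual_maximizers f h A b"
    and running: "\<And>k. k < K \<Longrightarrow> \<not> outer_stop k (fst (iterate k)) (snd (iterate k))"
  shows "5 / 8 * real K - 3 / 4 / (1 - \<alpha>) \<le> (norm ls)\<^sup>2"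
proof -
  have eps_eq: "eps k = \<epsilon> * (\<alpha> ^ k + 1 / 2) / 2" for k
  proof -
    have "\<sigma> * \<rho> * \<epsilon>\<^sup>2 = \<sigma> * (\<rho> * \<epsilon>) * \<epsilon>" by (simp add: power2_eq_square)
    also have "\<dots> = \<epsilon> / 2" unfolding rho_eps \<open>\<sigma> = 1 / 2\<close> by simp
    finally have "(\<epsilon>0 * \<alpha> ^ k + \<sigma> * \<rho> * \<epsilon>\<^sup>2) / 2 = \<epsilon> * (\<alpha> ^ k + 1 / 2) / 2"
      unfolding \<open>\<epsilon>0 = \<epsilon>\<close> by (simp add: distrib_left)
    then show ?thesis unfolding eps_def .
  qed
  \<comment> \<open>Since \<open>eps k \<le> 3 / 4 * \<epsilon>\<close> and
    \<open>1 \<le> D\<close>, the gradient half of the stopping test always holds; a failure to stop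
    is therefore a constraint violation above \<epsilon>, which the update scales by \<rho>.\<close>
  have step: "1 \<le> (norm (snd (iterate (Suc k)) - snd (iterate k)))\<^sup>2" if k: "k < K" for k
  proof -
    let ?x = "fst (iterate k)" and ?l = "snd (iterate k)"
    have "\<alpha> ^ k \<le> 1" using alpha by (simp add: power_le_one)
    then have "eps k \<le> \<epsilon> * (1 + 1 / 2) / 2" unfolding eps_eq using eps by (intro divide_right_mono mult_left_mono) auto
    then have "eps k \<le> \<epsilon>" using eps by simp
    then have "eps k \<le> \<epsilon> * D" using mult_left_mono[OF \<open>1 \<le> D\<close> less_imp_le[OF eps]] eps by linarith
    then have "eps k / (2 * D) \<le> \<epsilon> / 2" using D_pos by (simp add: divide_le_eq)
    then have "norm (G k ?l (x_tilde k ?x ?l)) \<le> \<epsilon> / 2"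
      using x_tilde_stop[OF iterate_in_dom, of k ?l k] by linarith
    then have "\<epsilon> < norm (A *v x_next k ?x ?l - b)" using running[OF k] unfolding outer_stop_def by linarith
    then have "\<rho> * \<epsilon> < \<rho> * norm (A *v x_next k ?x ?l - b)" using rho by simp
    moreover have "snd (iterate (Suc k)) - ?l = \<rho> *\<^sub>R (A *v x_next k ?x ?l - b)" by (simp add: lam_next_def)
    ultimately have "1 \<le> norm (snd (iterate (Suc k)) - ?l)" using rho rho_eps by simp
    then show ?thesis using power_mono[of 1 _ 2] by simp
  qed
  have "(\<Sum>k<K. \<alpha> ^ k) \<le> 1 / (1 - \<alpha>)"
    using sum_le_suminf[OF summable_geometric, of \<alpha> "{..<K}"] suminf_geometric[of \<alpha>] alpha by simp
  moreover have "\<rho> * eps k = \<alpha> ^ k / 2 + 1 / 4" for k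
    unfolding eps_eq using rho_eps by (simp add: mult.assoc[symmetric] add_divide_distrib)
  then have "(\<Sum>k<K. \<rho> * eps k) = (\<Sum>k<K. \<alpha> ^ k) / 2 + real K / 4"
    by (simp add: sum.distrib sum_divide_distrib)
  moreover have "3 / 4 / (1 - \<alpha>) = 3 / 4 * (1 / (1 - \<alpha>))" by simp
  ultimately have "3 / 2 * (\<Sum>k<K. \<rho> * eps k) \<le> 3 / 4 / (1 - \<alpha>) + 3 / 8 * real K" by linarith
  moreover have "real K \<le> (\<Sum>k<K. (norm (snd (iterate (Suc k)) - snd (iterate k)))\<^sup>2)"
    using sum_mono[of "{..<K}" "\<lambda>_. 1::real", OF step] by simp
  ultimately show ?thesis
    using sum_multiplier_steps_le[OF ls, of K] zero_le_power2[of "norm (snd (iterate K) - ls)"] by linarith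
qed

text \<open>The lower bound on \<open>m\<close> comes from
  \<open>\<epsilon> / 4 \<le> eps k\<close>. It gives \<kappa> at most 16 \<open>W\<close>, whence
  \<open>sqrt (2 * \<kappa>)\<close> is at most 6 \<open>X\<close>. The logarithms contribute 2 + 3
  * 10 = 32 times \<open>ln Z\<close>; 200 exceeds both 3 + 32 and 6 * 32, the coefficients of 1 and
  of \<open>X\<close>.\<close>

lemma acg_count_le:
  fixes Lf a D \<epsilon> m M :: real
  assumes "0 \<le> Lf" "0 \<le> a" "1 \<le> D" "0 < \<epsilon>" and m: "\<epsilon> / (16 * D\<^sup>2) \<le> m" and M: "M = Lf + 1 / \<epsilon> * a\<^sup>2"
  shows "3 + (1 + sqrt (2 * (M / m))) * (ln (25 / 4) + 3 * ln (1 + 2 * (M / m)))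
    \<le> 200 * soft_O_log Lf a D \<epsilon> * (1 + D * (sqrt Lf / sqrt \<epsilon> + a / \<epsilon>))"
proof -
  define Z where "Z = 2 + Lf + a + D + 1 / \<epsilon>"
  define X where "X = D * (sqrt Lf / sqrt \<epsilon> + a / \<epsilon>)"
  define \<kappa> where "\<kappa> = M / m"
  define W where "W = D\<^sup>2 * (Lf * (1 / \<epsilon>) + a\<^sup>2 * (1 / \<epsilon>)\<^sup>2)"
  have e: "0 < 1 / \<epsilon>" using assms by simp
  \<comment> \<open>\<open>3 \<le> Z\<close> rests on the summand 2 in the logarithm and on
    \<open>1 \<le> D\<close>. It yields \<open>1 \<le> ln Z\<close>, which absorbs additive
    constants, and \<open>81 \<le> Z ^ 4\<close>, which absorbs the factors in \<kappa>.\<close>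
  have Z: "3 \<le> Z" "Lf \<le> Z" "a \<le> Z" "D \<le> Z" "1 / \<epsilon> \<le> Z" unfolding Z_def using assms e by linarith+
  have M0: "0 \<le> M" unfolding M using assms by simp
  have m0: "0 < \<epsilon> / (16 * D\<^sup>2)" using assms by simp
  have \<kappa>0: "0 \<le> \<kappa>" unfolding \<kappa>_def using M0 m m0 by simp
  have "\<kappa> \<le> M / (\<epsilon> / (16 * D\<^sup>2))" unfolding \<kappa>_def using M0 m m0 by (intro divide_left_mono mult_pos_pos) linarith+
  also have "\<dots> = 16 * D\<^sup>2 * (Lf * (1 / \<epsilon>) + a\<^sup>2 * (1 / \<epsilon>)\<^sup>2)"
    unfolding M using assms by (simp add: field_simps power2_eq_square)
  also have "\<dots> = 16 * W" by (simp add: W_def)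
  finally have \<kappa>: "\<kappa> \<le> 16 * W" .
  have W0: "0 \<le> W" unfolding W_def using assms by simp
  have X0: "0 \<le> X" unfolding X_def using assms by simp
  have "sqrt (2 * \<kappa>) \<le> 6 * X"
  proof (rule real_le_lsqrt)
    have "2 * \<kappa> \<le> 36 * W" using \<kappa> W0 by linarith
    also have "\<dots> \<le> 36 * (D\<^sup>2 * (sqrt Lf / sqrt \<epsilon> + a / \<epsilon>)\<^sup>2)"
    proof -
      have "0 \<le> sqrt Lf / sqrt \<epsilon> * (a / \<epsilon>)" using assms by simp
      then have "Lf * (1 / \<epsilon>) + a\<^sup>2 * (1 / \<epsilon>)\<^sup>2 \<le> (sqrt Lf / sqrt \<epsilon> + a / \<epsilon>)\<^sup>2"
        using assms unfolding power2_sum by (simp add: power_divide)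
      then show ?thesis unfolding W_def by (intro mult_left_mono) auto
    qed
    finally show "2 * \<kappa> \<le> (6 * X)\<^sup>2" by (simp add: X_def power_mult_distrib)
  qed (use \<kappa>0 X0 in auto)
  have lnZ: "1 \<le> ln Z" using Z exp_le by (subst ln_ge_iff) auto
  have "ln (25 / 4) \<le> ln (Z ^ 2)"
    using Z power_mono[of 3 Z 2] by (subst ln_le_cancel_iff) auto
  then have l1: "ln (25 / 4) \<le> 2 * ln Z" using Z by (simp add: ln_realpow)
  have "1 + 2 * \<kappa> \<le> Z ^ 10"
  proof -
    have "W \<le> Z\<^sup>2 * (Z * Z + Z\<^sup>2 * Z\<^sup>2)"
      unfolding W_def using Z assms by (intro mult_mono add_mono power_mono) auto
    also have "\<dots> = Z ^ 4 + Z ^ 6" by (simp add: power2_eq_square power4_eq_xxxx power_numeral_reduce algebra_simps)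
    finally have W: "W \<le> Z ^ 4 + Z ^ 6" .
    have Z46: "Z ^ 4 \<le> Z ^ 6" "1 \<le> Z ^ 6" using Z by (auto intro: power_increasing one_le_power)
    have "81 * Z ^ 6 \<le> Z ^ 4 * Z ^ 6" using Z power_mono[of 3 Z 4] by (intro mult_right_mono) auto
    also have "\<dots> = Z ^ 10" by (simp add: power_add[symmetric])
    finally have Z10: "81 * Z ^ 6 \<le> Z ^ 10" .
    have "1 + 2 * \<kappa> \<le> z" if "W \<le> u + w" "u \<le> w" "1 \<le> w" "81 * w \<le> z" for u w z
      using that \<kappa> by linarith
    from this[OF W Z46 Z10] show ?thesis .
  qed
  then have "ln (1 + 2 * \<kappa>) \<le> ln (Z ^ 10)" using \<kappa>0 by (subst ln_le_cancel_iff) auto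
  then have l2: "ln (1 + 2 * \<kappa>) \<le> 10 * ln Z" using Z by (simp add: ln_realpow)
  have "0 \<le> ln (1 + 2 * \<kappa>)" using \<kappa>0 by simp
  then have "(1 + sqrt (2 * \<kappa>)) * (ln (25 / 4) + 3 * ln (1 + 2 * \<kappa>)) \<le> (1 + 6 * X) * (32 * ln Z)"
    using \<open>sqrt (2 * \<kappa>) \<le> 6 * X\<close> l1 l2 X0 by (intro mult_mono) auto
  moreover have "0 \<le> X * ln Z" using X0 lnZ by simp
  ultimately have "3 + (1 + sqrt (2 * \<kappa>)) * (ln (25 / 4) + 3 * ln (1 + 2 * \<kappa>)) \<le> 200 * ln Z * (1 + X)"
    using lnZ by (simp add: algebra_simps)
  then show ?thesis by (simp add: soft_O_log_def Z_def X_def \<kappa>_def)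
qed

theorem theorem3p1:
  fixes f :: "real^'n \<Rightarrow> real" and h :: "real^'n \<Rightarrow> ereal"
    and A :: "real^'n^'m" and b :: "real^'m"
    and Lf D \<epsilon> \<alpha> :: real and x0 :: "real^'n" and t :: "nat \<Rightarrow> nat \<Rightarrow> bool"
  assumes "CARD('m) \<le> CARD('n)"
    and "proper_closed_convex (\<lambda>x. ereal (f x))"
    and "smooth_with Lf f"
    and "proper_closed_convex h"
    and "rel_interior (ext_dom h) \<inter> {x. A *v x = b} \<noteq> {}"
    and "bounded (ext_dom h)"
    and "D = diameter (ext_dom h)"
    and "1 \<le> D"
    and "0 < Lf \<or> A \<noteq> 0"
    and "x0 \<in> ext_dom h"
    and "0 < \<alpha>" and "\<alpha> < 1"
    and "0 < \<epsilon>"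
  shows "\<exists>N x lam.
           ialm.returns f h A b Lf D x0 (1 / \<epsilon>) \<epsilon> \<alpha> \<epsilon> (1 / 2) t N x lam \<and>
           eps_primal_dual f h A b \<epsilon> x lam \<and>
           real N \<le> soft_O_const \<alpha> * soft_O_log Lf (spectral_norm A) D \<epsilon> *
             ((1 + (dual_radius f h A b 0)\<^sup>2) *
              (1 + D * (sqrt Lf / sqrt \<epsilon> + spectral_norm A / \<epsilon>)))"
proof -
  have f: "convex_on UNIV f" using assms(2) by (rule convex_on_of_ereal)
  have diam: "norm (x - y) \<le> D" if "x \<in> ext_dom h" "y \<in> ext_dom h" for x y
    using diameter_bounded_bound[OF assms(6) that] assms(7) by (simp add: dist_norm)
  interpret ialm_problem f h A b Lf D x0 "1 / \<epsilon>" \<epsilon> \<alpha> \<epsilon> "1 / 2" t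
    using assms f diam by unfold_locales auto
  have dual: "dual_maximizers f h A b \<noteq> {}"
    by (rule dual_maximizers_nonempty[OF f assms(4,6,5)])
  let ?R = "(dual_radius f h A b 0)\<^sup>2"
  let ?stop = "\<lambda>k. outer_stop k (fst (iterate k)) (snd (iterate k))"
  have outer: "5 / 8 * real K - 3 / 4 / (1 - \<alpha>) \<le> ?R" if "\<And>k. k < K \<Longrightarrow> \<not> ?stop k" for K
  proof (rule le_dual_radius_sq[OF dual])
    fix ls assume "ls \<in> dual_maximizers f h A b"
    from outer_iterations_le[OF _ _ _ assms(8) this that] assms(13)
    show "5 / 8 * real K - 3 / 4 / (1 - \<alpha>) \<le> (norm (ls - 0))\<^sup>2" by simp
  qed
  have "\<exists>k. ?stop k"
  proof (rule ccontr)
    assume "\<not> ?thesis"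
    moreover obtain K :: nat where "8 / 5 * (?R + 3 / 4 / (1 - \<alpha>)) < real K" using reals_Archimedean2 by blast
    ultimately show False using outer[of K] by force
  qed
  define K where "K = (LEAST k. ?stop k)"
  have K: "?stop K" "\<And>k. k < K \<Longrightarrow> \<not> ?stop k"
    unfolding K_def using LeastI_ex[OF \<open>\<exists>k. ?stop k\<close>] not_less_Least[of _ ?stop] by blast+
  define N where "N = (\<Sum>k\<le>K. (acg_last k (fst (iterate k)) (snd (iterate k)) + 1))"
  define B where "B = soft_O_log Lf (spectral_norm A) D \<epsilon> * (1 + D * (sqrt Lf / sqrt \<epsilon> + spectral_norm A / \<epsilon>))"
  have Lf: "0 \<le> Lf" using assms(3) by (rule smooth_with_nonneg)
  have call: "real (acg_last k (fst (iterate k)) (snd (iterate k)) + 1) \<le> 200 * B" for k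
  proof -
    \<comment> \<open>The constant summand in \<open>eps k\<close> keeps the tolerances from
      decaying with \<open>k\<close>, which makes the call bound uniform.\<close>
    have "\<epsilon> / 4 \<le> eps k"
      using assms by (simp add: eps_def power2_eq_square)
    then have "\<epsilon> / 4 / (4 * D\<^sup>2) \<le> mu k" unfolding mu_def by (intro divide_right_mono) auto
    then have "\<epsilon> / (16 * D\<^sup>2) \<le> mu k" by simp
    from acg_count_le[OF Lf spectral_norm_nonneg assms(8,13) this M_def]
      acg_call_bound(2)[OF iterate_in_dom, of k k "snd (iterate k)"]
    show ?thesis by (simp add: B_def mult.assoc)
  qed
  have "1 \<le> 200 * B" using call[of 0] by simp
  have "real N = (\<Sum>k\<le>K. real (acg_last k (fst (iterate k)) (snd (iterate k)) + 1))" by (simp add: N_def)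
  also have "\<dots> \<le> (\<Sum>k\<le>K. 200 * B)" by (intro sum_mono call)
  also have "\<dots> = (real K + 1) * (200 * B)" by (simp add: algebra_simps)
  \<comment> \<open>The outer bound gives \<open>real K + 1\<close> at most 8/5 \<open>?R\<close> +
    6/5 / (1 - \<alpha>) + 1, and 3 covers both 8/5 and 6/5 + 1.\<close>
  also have "\<dots> \<le> (3 / (1 - \<alpha>) * (1 + ?R)) * (200 * B)"
  proof (rule mult_right_mono)
    have "?R \<le> 1 / (1 - \<alpha>) * ?R" "1 \<le> 1 / (1 - \<alpha>)"
      using assms(11,12) by (auto simp: le_divide_eq mult_left_le)
    moreover have "3 / 4 / (1 - \<alpha>) = 3 / 4 * (1 / (1 - \<alpha>))"
      "3 / (1 - \<alpha>) * (1 + ?R) = 3 * (1 / (1 - \<alpha>)) + 3 * (1 / (1 - \<alpha>) * ?R)" by (simp_all add: distrib_left)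
    ultimately show "real K + 1 \<le> 3 / (1 - \<alpha>) * (1 + ?R)"
      using outer[of K, OF K(2)] zero_le_power2[of "dual_radius f h A b 0"] by linarith
  qed (use \<open>1 \<le> 200 * B\<close> in simp)
  also have "\<dots> = 600 / (1 - \<alpha>) * ((1 + ?R) * B)" by simp
  also have "\<dots> \<le> 10 ^ 4 / (1 - \<alpha>) * ((1 + ?R) * B)"
    using assms(12) \<open>1 \<le> 200 * B\<close> by (intro mult_right_mono divide_right_mono) auto
  also have "\<dots> = soft_O_const \<alpha> * soft_O_log Lf (spectral_norm A) D \<epsilon> *
      ((1 + ?R) * (1 + D * (sqrt Lf / sqrt \<epsilon> + spectral_norm A / \<epsilon>)))"
    by (simp add: soft_O_const_def B_def)
  finally have "real N \<le> soft_O_const \<alpha> * soft_O_log Lf (spectral_norm A) D \<epsilon> *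
      ((1 + ?R) * (1 + D * (sqrt Lf / sqrt \<epsilon> + spectral_norm A / \<epsilon>)))" .
  then show ?thesis
    using returns_at_first_outer_stop[OF K] unfolding N_def by blast
qed

end
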